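(* There exists a finitely generated residually finite group that has solvable word problem but does not have computable finite quotients (CFQ).
   Context: Let $G$ be a group generated by a finite set $S$. A marked finite group is a pair $(F,f)$ with $F$ a finite group (given by its multiplication table, or equivalently a finite presentation) and $f:S\to F$ a function. $G$ has CFQ (computable finite quotients) if there is an algorithm which, given $(F,f)$, decides whether $f$ extends to a group homomorphism $\hat f:G\to F$ (i.e. $\hat f(s)=f(s)$ for all $s\in S$). This property does not depend on the choice of the finite generating set $S$. *)

theory Defs
  imports "HOL-Algebra.Generated_Groups" "HOL-Library.Nat_Bijection"
begin

datatype recf = Zero | Succ | Proj nat | Comp recf "recf list" | PrimRec recf recf | Minim recf

inductive reval :: "recf \<Rightarrow> nat list \<Rightarrow> nat \<Rightarrow> bool" where
  zero: "reval Zero xs 0"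
| succ: "reval Succ [x] (Suc x)"
| proj: "i < length xs \<Longrightarrow> reval (Proj i) xs (xs ! i)"
| comp: "list_all2 (\<lambda>f y. reval f xs y) fs ys \<Longrightarrow> reval g ys r \<Longrightarrow> reval (Comp g fs) xs r"
| pr0: "reval f xs r \<Longrightarrow> reval (PrimRec f g) (0 # xs) r"
| prS: "reval (PrimRec f g) (n # xs) r \<Longrightarrow> reval g (n # r # xs) r'
         \<Longrightarrow> reval (PrimRec f g) (Suc n # xs) r'"
| mn: "reval f (n # xs) 0 \<Longrightarrow> (\<forall>m<n. \<exists>r. reval f (m # xs) r \<and> 0 < r)
         \<Longrightarrow> reval (Minim f) xs n"
monos list_all2_mono

definition computable :: "(nat \<Rightarrow> nat) \<Rightarrow> bool" where
  "computable f \<longleftrightarrow> (\<exists>p. \<forall>n. reval p [n] (f n))"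

text \<open>A finite generating set is given as a list gens = [s_0,...,s_{k-1}].
  Words over S \<union> S^-1 are lists of letters: letter 2i stands for s_i, letter 2i+1 for s_i^-1.\<close>

definition fin_generates :: "('a, 'b) monoid_scheme \<Rightarrow> 'a list \<Rightarrow> bool" where
  "fin_generates G gens \<longleftrightarrow> set gens \<subseteq> carrier G \<and> generate G (set gens) = carrier G"

definition valid_word :: "'a list \<Rightarrow> nat list \<Rightarrow> bool" where
  "valid_word gens w \<longleftrightarrow> (\<forall>a\<in>set w. a < 2 * length gens)"

definition letter_val :: "('a, 'b) monoid_scheme \<Rightarrow> 'a list \<Rightarrow> nat \<Rightarrow> 'a" where
  "letter_val G gens a =
     (if even a then gens ! (a div 2) else inv\<^bsub>G\<^esub> (gens ! (a div 2)))"

definition word_val :: "('a, 'b) monoid_scheme \<Rightarrow> 'a list \<Rightarrow> nat list \<Rightarrow> 'a" where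
  "word_val G gens w = foldr (\<lambda>a x. letter_val G gens a \<otimes>\<^bsub>G\<^esub> x) w \<one>\<^bsub>G\<^esub>"

definition solvable_WP_wrt :: "('a, 'b) monoid_scheme \<Rightarrow> 'a list \<Rightarrow> bool" where
  "solvable_WP_wrt G gens \<longleftrightarrow>
     (\<exists>c. computable c \<and>
        (\<forall>w. valid_word gens w \<longrightarrow>
           c (list_encode w) = (if word_val G gens w = \<one>\<^bsub>G\<^esub> then 1 else 0)))"

definition solvable_WP :: "('a, 'b) monoid_scheme \<Rightarrow> bool" where
  "solvable_WP G \<longleftrightarrow> (\<exists>gens. fin_generates G gens \<and> solvable_WP_wrt G gens)"

definition table_one :: "nat list list \<Rightarrow> nat" where
  "table_one tab = (THE e. e < length tab \<and> (\<forall>x<length tab. tab ! e ! x = x \<and> tab ! x ! e = x))"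

definition table_group :: "nat list list \<Rightarrow> nat monoid" where
  "table_group tab =
     \<lparr>carrier = {..<length tab}, mult = (\<lambda>i j. tab ! i ! j), one = table_one tab\<rparr>"

text \<open>A marked finite group (F, f) is encoded by (tab, fl) with f(s_i) = fl ! i.\<close>
definition valid_marked :: "'a list \<Rightarrow> nat list list \<Rightarrow> nat list \<Rightarrow> bool" where
  "valid_marked gens tab fl \<longleftrightarrow>
     (\<forall>row\<in>set tab. length row = length tab) \<and> group (table_group tab) \<and>
     length fl = length gens \<and> (\<forall>y\<in>set fl. y < length tab)"

definition marked_code :: "nat list list \<Rightarrow> nat list \<Rightarrow> nat" where
  "marked_code tab fl = prod_encode (list_encode (map list_encode tab), list_encode fl)"

definition extends_to_hom :: "('a, 'b) monoid_scheme \<Rightarrow> 'a list \<Rightarrow> nat list list \<Rightarrow> nat list \<Rightarrow> bool" where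
  "extends_to_hom G gens tab fl \<longleftrightarrow>
     (\<exists>h \<in> hom G (table_group tab). \<forall>i<length gens. h (gens ! i) = fl ! i)"

definition CFQ_wrt :: "('a, 'b) monoid_scheme \<Rightarrow> 'a list \<Rightarrow> bool" where
  "CFQ_wrt G gens \<longleftrightarrow>
     (\<exists>c. computable c \<and>
        (\<forall>tab fl. valid_marked gens tab fl \<longrightarrow>
           c (marked_code tab fl) = (if extends_to_hom G gens tab fl then 1 else 0)))"

definition has_CFQ :: "('a, 'b) monoid_scheme \<Rightarrow> bool" where
  "has_CFQ G \<longleftrightarrow> (\<exists>gens. fin_generates G gens \<and> CFQ_wrt G gens)"

text \<open>Every finite group is isomorphic to one with carrier a subset of nat.\<close>
definition residually_finite :: "('a, 'b) monoid_scheme \<Rightarrow> bool" where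
  "residually_finite G \<longleftrightarrow>
     (\<forall>g\<in>carrier G. g \<noteq> \<one>\<^bsub>G\<^esub> \<longrightarrow>
        (\<exists>(F :: nat monoid) h. group F \<and> finite (carrier F) \<and> h \<in> hom G F \<and> h g \<noteq> \<one>\<^bsub>F\<^esub>))"

definition finitely_generated :: "('a, 'b) monoid_scheme \<Rightarrow> bool" where
  "finitely_generated G \<longleftrightarrow> (\<exists>gens. fin_generates G gens)"

end

theory Submission
  imports Defs "HOL-Library.Z2" "HOL-Algebra.Product_Groups"
begin

text \<open>
  Fix an enumeration of programs and let \<open>e\<close> range over its indices. Let \<open>L(m, s)\<close>, for
  \<open>s : \<int>/m \<rightarrow> \<int>/2\<close>, be the central extension by \<open>\<int>/2\<close> of the lamplighter group \<open>\<int>/2 \<wr> \<int>/m\<close>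
  in which the lamps \<open>a\<^sub>i = t\<^sup>i a t\<^sup>-\<^sup>i\<close> and \<open>a\<^sub>j\<close> have commutator \<open>s(i - j) + s(j - i)\<close>.
  If program \<open>e\<close> does not halt, take \<open>m = 2\<^sup>e\<^sup>+\<^sup>2\<close> and let \<open>s\<close> be the indicator of \<open>2\<^sup>e\<close>. If it halts at
  time \<open>u\<close>, enlarge the period and remove the single residue \<open>2\<^sup>e(4u + 1)\<close> from the support of \<open>s\<close>.
  Let \<open>G\<close> be the subgroup generated by \<open>t\<close> and \<open>a\<close> in the product of these finite groups.

  \<open>G\<close> is residually finite. Its word problem is solvable because a word of length \<open>n\<close> cannot see
  a residue removed after time \<open>n\<close>. But the finite group \<open>L(2\<^sup>e\<^sup>+\<^sup>2, [2\<^sup>e])\<close> is a marked quotient of \<open>G\<close>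
  iff program \<open>e\<close> does not halt: if it halts at time \<open>u\<close>, then \<open>a\<close> commutes in \<open>G\<close> with its
  conjugate by \<open>t\<close> to the power \<open>2\<^sup>e(4u + 1)\<close>, which fails in this group.
\<close>

section \<open>Computable functions\<close>

text \<open>Everything about halting sits in the central bits: whether the position and the lamps of
  a word are trivial is decided without knowing which programs halt. The commutator of two lamps is
  symmetric in their distance, \<open>s d + s (- d)\<close>, so the support of \<open>s\<close> must
  avoid its own negative. The residue \<open>2 ^ e\<close> modulo \<open>2 ^ (e + 2)\<close>
  achieves this: it consists of the numbers \<open>2 ^ e * (4 * k + 1)\<close>, whereas the odd part
  of their negatives is 3 modulo 4. The power of 2 also separates the programs: a distance is marked
  for at most one index \<open>e\<close>, so removing the mark there makes the commutator vanish in
  all factors.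

  The negation of \<open>has_CFQ\<close> ranges over all generating lists, so \<open>t, a\<close>
  alone are not enough. A marking of an arbitrary list has to be computed from \<open>e\<close>, and
  if program \<open>e\<close> halts, a homomorphism extending that marking need not send
  \<open>t, a\<close> to the intended elements. The change of generators is therefore carried out in
  both directions, uniformly in \<open>e\<close> and inside the tables, and its result is tested as
  part of the reduction.\<close>

lemma reval_Comp1: "reval f xs y \<Longrightarrow> reval g [y] r \<Longrightarrow> reval (Comp g [f]) xs r"
  by (rule reval.comp[of _ _ "[y]"]) auto

lemma reval_Comp2:
  "reval f xs y \<Longrightarrow> reval f' xs y' \<Longrightarrow> reval g [y, y'] r \<Longrightarrow> reval (Comp g [f, f']) xs r"
  by (rule reval.comp[of _ _ "[y, y']"]) auto

lemma reval_Proj0: "reval (Proj 0) (x # xs) x"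
  using reval.proj[of 0 "x # xs"] by simp

lemma reval_Proj1: "reval (Proj (Suc 0)) (x # y # xs) y"
  using reval.proj[of 1 "x # y # xs"] by simp

lemma reval_Proj2: "reval (Proj 2) (x # y # z # xs) z"
  using reval.proj[of 2 "x # y # z # xs"] by simp

lemmas reval_intros = reval_Comp1 reval_Comp2 reval_Proj0 reval_Proj1 reval_Proj2 reval.succ reval.zero

text \<open>Two genuine arguments are needed only until pairing is known to be computable;
  afterwards several inputs are packed into one number.\<close>

definition computable2 :: "(nat \<Rightarrow> nat \<Rightarrow> nat) \<Rightarrow> bool" where
  "computable2 f \<longleftrightarrow> (\<exists>p. \<forall>x y. reval p [x, y] (f x y))"

lemma computable2_add: "computable2 (+)"
proof -
  have "reval (PrimRec (Proj 0) (Comp Succ [Proj (Suc 0)])) [x, y] (x + y)" for x y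
    by (induction x) (auto intro!: reval.pr0 reval.prS reval_intros)
  then show ?thesis unfolding computable2_def by blast
qed

lemma computable2_diff: "computable2 (-)"
proof -
  define pred where "pred = Comp (PrimRec Zero (Proj 0)) [Proj 0, Proj 0]"
  have *: "reval (PrimRec Zero (Proj 0)) [x, y] (x - 1)" for x y
    by (induction x) (auto intro!: reval.pr0 reval.prS reval_intros)
  have pred: "reval pred [x] (x - 1)" for x
    unfolding pred_def by (intro reval_Comp2[OF reval_Proj0 reval_Proj0 *])
  \<comment> \<open>Primitive recursion runs on the first argument, so iterating \<open>pred\<close>
    subtracts in the wrong order; a final swap repairs this.\<close>
  have "reval (PrimRec (Proj 0) (Comp pred [Proj (Suc 0)])) [x, y] (y - x)" for x y
  proof (induction x)
    case (Suc x)
    then show ?case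
      using pred[of "y - x"] by (auto intro!: reval.prS reval_Comp1[OF reval_Proj1])
  qed (auto intro!: reval.pr0 reval_intros)
  then have "reval (Comp (PrimRec (Proj 0) (Comp pred [Proj (Suc 0)])) [Proj (Suc 0), Proj 0]) [x, y] (x - y)" for x y
    by (intro reval_Comp2[OF reval_Proj1 reval_Proj0])
  then show ?thesis unfolding computable2_def by blast
qed

lemma computable2_comp:
  assumes "computable2 f" "computable F" "computable G"
  shows "computable (\<lambda>v. f (F v) (G v))"
  using assms unfolding computable2_def computable_def by (meson reval_Comp2)

lemma computable_id: "computable (\<lambda>v. v)"
  unfolding computable_def by (blast intro: reval_Proj0)

lemma computable_comp: "computable f \<Longrightarrow> computable F \<Longrightarrow> computable (\<lambda>v. f (F v))"
  unfolding computable_def by (meson reval_Comp1)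

lemma computable_Suc: "computable F \<Longrightarrow> computable (\<lambda>v. Suc (F v))"
  unfolding computable_def by (meson reval_Comp1 reval.succ)

lemma computable_const: "computable (\<lambda>v. c)"
proof (induction c)
  case 0
  show ?case unfolding computable_def by (blast intro: reval.zero)
qed (rule computable_Suc)

lemma computable_raw_primrec:
  assumes "computable2 g"
  shows "computable (rec_nat a g)"
proof -
  obtain A where A: "reval A [x] a" for x using computable_const[of a] unfolding computable_def by blast
  obtain p where p: "reval p [x, y] (g x y)" for x y using assms unfolding computable2_def by blast
  have "reval (PrimRec A (Comp p [Proj 0, Proj (Suc 0)])) [n, x] (rec_nat a g n)" for n x
    by (induction n) (auto intro!: reval.pr0 reval.prS reval_intros A p)
  then have "reval (Comp (PrimRec A (Comp p [Proj 0, Proj (Suc 0)])) [Proj 0, Proj 0]) [n] (rec_nat a g n)" for n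
    by (intro reval_Comp2[OF reval_Proj0 reval_Proj0])
  then show ?thesis unfolding computable_def by blast
qed

section \<open>Cantor pairing and its inverse\<close>

lemma computable_triangle: "computable triangle"
proof -
  have "computable2 (\<lambda>n r. r + Suc n)"
    using computable2_add unfolding computable2_def by (meson reval_intros)
  then have "computable (rec_nat 0 (\<lambda>n r. r + Suc n))" by (rule computable_raw_primrec)
  moreover have "rec_nat 0 (\<lambda>n r. r + Suc n) = triangle"
  proof
    show "rec_nat 0 (\<lambda>n r. r + Suc n) n = triangle n" for n by (induction n) auto
  qed
  ultimately show ?thesis by simp
qed

lemma computable2_prod_encode: "computable2 (\<lambda>x y. prod_encode (x, y))"
proof -
  obtain p where p: "reval p [x, y] (x + y)" for x y using computable2_add unfolding computable2_def by blast
  obtain q where q: "reval q [x] (triangle x)" for x using computable_triangle unfolding computable_def by blast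
  have "reval (Comp p [Comp q [p], Proj 0]) [x, y] (triangle (x + y) + x)" for x y
    by (rule reval_intros p q)+
  then show ?thesis unfolding computable2_def prod_encode_def by auto
qed

definition pfst :: "nat \<Rightarrow> nat" where "pfst v = fst (prod_decode v)"
definition psnd :: "nat \<Rightarrow> nat" where "psnd v = snd (prod_decode v)"

lemma pfst_prod_encode [simp]: "pfst (prod_encode (x, y)) = x"
  and psnd_prod_encode [simp]: "psnd (prod_encode (x, y)) = y"
  and prod_encode_pfst_psnd [simp]: "prod_encode (pfst v, psnd v) = v"
  by (simp_all add: pfst_def psnd_def)

lemma computable_diff: "computable F \<Longrightarrow> computable G \<Longrightarrow> computable (\<lambda>v. F v - G v)"
  by (rule computable2_comp[OF computable2_diff])

text \<open>Inverting the Cantor pairing starts with finding the diagonal of \<open>v\<close>: it is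
  the least \<open>n\<close> with \<open>v < triangle (Suc n)\<close>, and the truncated difference
  in \<open>body\<close> vanishes exactly then.\<close>

lemma computable_pfst_psnd_add: "computable (\<lambda>v. pfst v + psnd v)"
proof -
  obtain p where p: "reval p [x, y] (x - y)" for x y using computable2_diff unfolding computable2_def by blast
  obtain q where q: "reval q [x] (triangle x)" for x using computable_triangle unfolding computable_def by blast
  define body where "body = Comp p [Comp Succ [Proj (Suc 0)], Comp q [Comp Succ [Proj 0]]]"
  have body: "reval body [n, v] (Suc v - triangle (Suc n))" for n v
    unfolding body_def by (rule reval_intros p q)+
  have tri_mono: "triangle m \<le> triangle n" if "m \<le> n" for m n
    using that by (induction rule: dec_induct) auto
  have "reval (Minim body) [v] (pfst v + psnd v)" for v
  proof (rule reval.mn)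
    have v: "v = triangle (pfst v + psnd v) + pfst v"
      using prod_encode_pfst_psnd[of v] unfolding prod_encode_def by simp
    have "Suc v - triangle (Suc (pfst v + psnd v)) = 0" by (subst (1) v) simp
    then show "reval body [pfst v + psnd v, v] 0" using body[of "pfst v + psnd v" v] by simp
    show "\<forall>m<pfst v + psnd v. \<exists>r. reval body [m, v] r \<and> 0 < r"
    proof (intro allI impI exI conjI)
      fix m assume m: "m < pfst v + psnd v"
      show "reval body [m, v] (Suc v - triangle (Suc m))" by (rule body)
      show "0 < Suc v - triangle (Suc m)" using tri_mono[of "Suc m" "pfst v + psnd v"] m v by linarith
    qed
  qed
  then show ?thesis unfolding computable_def by blast
qed

lemma computable_pfst: "computable F \<Longrightarrow> computable (\<lambda>v. pfst (F v))"
proof -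
  assume "computable F"
  moreover have "computable (\<lambda>v. v - triangle (pfst v + psnd v))"
    by (intro computable_diff computable_id computable_comp[OF computable_triangle] computable_pfst_psnd_add)
  moreover have "v - triangle (pfst v + psnd v) = pfst v" for v
    using prod_encode_pfst_psnd[of v] unfolding prod_encode_def by simp
  ultimately show ?thesis using computable_comp[of pfst F] by simp
qed

lemma computable_psnd: "computable F \<Longrightarrow> computable (\<lambda>v. psnd (F v))"
proof -
  assume "computable F"
  moreover have "computable (\<lambda>v. (pfst v + psnd v) - pfst v)"
    by (intro computable_diff computable_pfst_psnd_add computable_pfst computable_id)
  ultimately show ?thesis using computable_comp[of psnd F] by simp
qed

lemma computable_prod_encode:
  "computable F \<Longrightarrow> computable G \<Longrightarrow> computable (\<lambda>v. prod_encode (F v, G v))"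
  by (rule computable2_comp[OF computable2_prod_encode])

lemma computable_add: "computable F \<Longrightarrow> computable G \<Longrightarrow> computable (\<lambda>v. F v + G v)"
  by (rule computable2_comp[OF computable2_add])

text \<open>A body with a bound variable, as in sums, bounded quantifiers and recursions, becomes
  unary by packing that variable with the parameter; this rule instantiates such a packed function
  again.\<close>

lemma computable_lift2:
  assumes "computable (\<lambda>w. f (pfst w) (psnd w))" "computable F" "computable G"
  shows "computable (\<lambda>v. f (F v) (G v))"
  using computable_comp[OF assms(1) computable_prod_encode[OF assms(2,3)]] by simp

lemma computable_lift3:
  assumes "computable (\<lambda>w. f (pfst w) (pfst (psnd w)) (psnd (psnd w)))"
    "computable F" "computable G" "computable H"
  shows "computable (\<lambda>v. f (F v) (G v) (H v))"
  using computable_comp[OF assms(1) computable_prod_encode[OF assms(2) computable_prod_encode[OF assms(3,4)]]]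
  by simp

lemma computable_rec_nat:
  assumes a: "computable a" and b: "computable b"
    and g: "computable (\<lambda>w. g (pfst w) (pfst (psnd w)) (psnd (psnd w)))"
  shows "computable (\<lambda>v. rec_nat (a v) (\<lambda>n r. g n r v) (b v))"
proof -
  obtain A where A: "reval A [v] (a v)" for v using a unfolding computable_def by blast
  obtain p where p: "reval p [w] (g (pfst w) (pfst (psnd w)) (psnd (psnd w)))" for w
    using g unfolding computable_def by blast
  obtain q where q: "reval q [x, y] (prod_encode (x, y))" for x y
    using computable2_prod_encode unfolding computable2_def by blast
  define G where "G = Comp p [Comp q [Proj 0, Comp q [Proj (Suc 0), Proj 2]]]"
  have G: "reval G [n, r, v] (g n r v)" for n r v
    unfolding G_def using p[of "prod_encode (n, prod_encode (r, v))"] by (auto intro!: reval_intros q)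
  have "reval (PrimRec A G) [n, v] (rec_nat (a v) (\<lambda>n r. g n r v) n)" for n v
    by (induction n) (auto intro!: reval.pr0 reval.prS A G)
  then have "computable2 (\<lambda>n v. rec_nat (a v) (\<lambda>n r. g n r v) n)" unfolding computable2_def by blast
  from computable2_comp[OF this b computable_id] show ?thesis .
qed

section \<open>Closure rules for computable functions and decidable predicates\<close>

named_theorems computable_intros

declare computable_id [computable_intros] computable_const [computable_intros]
  computable_Suc [computable_intros] computable_pfst [computable_intros] computable_psnd [computable_intros]
  computable_prod_encode [computable_intros] computable_add [computable_intros]
  computable_diff [computable_intros]

lemma computable_sum [computable_intros]:
  assumes "computable b" "computable (\<lambda>w. f (pfst w) (psnd w))"
  shows "computable (\<lambda>v. \<Sum>x<b v. f x v)"
proof -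
  have "computable (\<lambda>v. rec_nat 0 (\<lambda>n r. r + f n v) (b v))"
    by (intro computable_rec_nat computable_intros assms computable_lift2[OF assms(2)])
  moreover have "rec_nat 0 (\<lambda>n r. r + f n v) k = (\<Sum>x<k. f x v)" for v k
    by (induction k) auto
  ultimately show ?thesis by simp
qed

lemma computable_mult [computable_intros]:
  assumes "computable F" "computable G"
  shows "computable (\<lambda>v. F v * G v)"
proof -
  have "computable (\<lambda>v. \<Sum>x<F v. G v)"
    by (intro computable_intros assms computable_comp[OF assms(2)])
  then show ?thesis by simp
qed

lemma computable_power [computable_intros]:
  assumes "computable F" "computable G"
  shows "computable (\<lambda>v. F v ^ G v)"
proof -
  have "computable (\<lambda>v. rec_nat 1 (\<lambda>n r. F v * r) (G v))"
    by (intro computable_rec_nat computable_intros assms computable_comp[OF assms(1)])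
  moreover have "rec_nat 1 (\<lambda>n r. x * r) k = x ^ k" for x k :: nat
    by (induction k) auto
  ultimately show ?thesis by simp
qed

definition decidable :: "(nat \<Rightarrow> bool) \<Rightarrow> bool" where
  "decidable P \<longleftrightarrow> computable (\<lambda>v. if P v then 1 else 0)"

lemma computable_if [computable_intros]:
  assumes "decidable P" "computable F" "computable G"
  shows "computable (\<lambda>v. if P v then F v else G v)"
proof -
  have "computable (\<lambda>v. (if P v then 1 else 0) * F v + (1 - (if P v then 1 else 0)) * G v)"
    using assms(1) unfolding decidable_def by (intro computable_intros assms(2,3))
  moreover have "(if P v then 1 else 0) * F v + (1 - (if P v then 1 else 0)) * G v = (if P v then F v else G v)" for v
    by simp
  ultimately show ?thesis by simp
qed

lemma decidable_le [computable_intros]: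
  assumes "computable F" "computable G"
  shows "decidable (\<lambda>v. F v \<le> G v)"
proof -
  have "computable (\<lambda>v. 1 - (F v - G v))" by (intro computable_intros assms)
  moreover have "1 - (F v - G v) = (if F v \<le> G v then 1 else 0)" for v by auto
  ultimately show ?thesis unfolding decidable_def by simp
qed

lemma decidable_not [computable_intros]:
  assumes "decidable P"
  shows "decidable (\<lambda>v. \<not> P v)"
proof -
  have "computable (\<lambda>v. if P v then 0 else 1)" by (intro computable_intros assms)
  moreover have "(if P v then 0 else 1) = (if \<not> P v then 1 else 0::nat)" for v by simp
  ultimately show ?thesis unfolding decidable_def by simp
qed

lemma decidable_conj [computable_intros]:
  assumes "decidable P" "decidable Q"
  shows "decidable (\<lambda>v. P v \<and> Q v)"
proof -
  have "computable (\<lambda>v. if P v then if Q v then 1 else 0 else 0)"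
    by (intro computable_intros assms)
  moreover have "(if P v then if Q v then 1 else 0 else 0) = (if P v \<and> Q v then 1 else 0::nat)" for v by simp
  ultimately show ?thesis unfolding decidable_def by simp
qed

lemma decidable_disj [computable_intros]:
  "decidable P \<Longrightarrow> decidable Q \<Longrightarrow> decidable (\<lambda>v. P v \<or> Q v)"
  using decidable_not[OF decidable_conj[OF decidable_not[of P] decidable_not[of Q]]] by simp

lemma decidable_imp [computable_intros]:
  "decidable P \<Longrightarrow> decidable Q \<Longrightarrow> decidable (\<lambda>v. P v \<longrightarrow> Q v)"
  using decidable_disj[OF decidable_not[of P], of Q] by (simp only: imp_conv_disj)

lemma decidable_less [computable_intros]:
  "computable F \<Longrightarrow> computable G \<Longrightarrow> decidable (\<lambda>v. F v < G v)"
  using decidable_le[OF computable_Suc[of F], of G] by (simp add: Suc_le_eq)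

lemma decidable_eq [computable_intros]:
  fixes F G :: "nat \<Rightarrow> nat"
  shows "computable F \<Longrightarrow> computable G \<Longrightarrow> decidable (\<lambda>v. F v = G v)"
  using decidable_conj[OF decidable_le[of F G] decidable_le[of G F]] by (simp add: eq_iff)

lemma decidable_ex_less [computable_intros]:
  assumes "computable b" "decidable (\<lambda>w. P (pfst w) (psnd w))"
  shows "decidable (\<lambda>v. \<exists>x<b v. P x v)"
proof -
  have "decidable (\<lambda>v. 0 < (\<Sum>x<b v. if P x v then 1 else 0 :: nat))"
    by (intro computable_intros assms)
  moreover have "0 < (\<Sum>x<b v. if P x v then 1 else 0 :: nat) \<longleftrightarrow> (\<exists>x<b v. P x v)" for v
  proof -
    have "(\<Sum>x<b v. if P x v then 1 else 0 :: nat) = card {x. x < b v \<and> P x v}"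
      by (simp add: sum.If_cases Int_def lessThan_def)
    then show ?thesis by (auto simp: card_gt_0_iff)
  qed
  ultimately show ?thesis by (simp only:)
qed

lemma decidable_all_less [computable_intros]:
  assumes "computable b" "decidable (\<lambda>w. P (pfst w) (psnd w))"
  shows "decidable (\<lambda>v. \<forall>x<b v. P x v)"
  using decidable_not[OF decidable_ex_less[OF assms(1) decidable_not[OF assms(2)]]] by simp

lemma decidable_comp: "decidable P \<Longrightarrow> computable F \<Longrightarrow> decidable (\<lambda>v. P (F v))"
  unfolding decidable_def by (rule computable_comp)

lemma decidable_lift2:
  assumes "decidable (\<lambda>w. P (pfst w) (psnd w))" "computable F" "computable G"
  shows "decidable (\<lambda>v. P (F v) (G v))"
  using decidable_comp[OF assms(1) computable_prod_encode[OF assms(2,3)]] by simp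

text \<open>The quotient counts the positive multiples of the divisor up to the dividend. Divisor 0
  is split off, as there every multiple would count although the quotient is 0.\<close>

lemma computable_div [computable_intros]:
  assumes "computable F" "computable G"
  shows "computable (\<lambda>v. F v div G v)"
proof -
  have *: "computable (\<lambda>w. if psnd w = 0 then 0 else \<Sum>x<pfst w. if Suc x * psnd w \<le> pfst w then 1 else 0)"
    by (intro computable_intros)
  have "(if n = 0 then 0 else \<Sum>x<m. if Suc x * n \<le> m then 1 else 0) = m div n" for m n :: nat
  proof (cases "n = 0")
    case False
    have "{x. x < m \<and> Suc x * n \<le> m} = {..<m div n}"
    proof -
      have "Suc x * n \<le> m \<longleftrightarrow> x < m div n" for x
        using False by (metis Suc_le_eq less_eq_div_iff_mult_less_eq bot_nat_0.not_eq_extremum)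
      moreover have "x < m" if "x < m div n" for x
        using that by (meson div_le_dividend order_less_le_trans)
      ultimately show ?thesis by auto
    qed
    then show ?thesis using False by (simp add: sum.If_cases Int_def lessThan_def)
  qed auto
  then have "computable (\<lambda>w. pfst w div psnd w)" using * by simp
  from computable_lift2[OF this assms] show ?thesis .
qed

lemma computable_mod [computable_intros]:
  assumes "computable F" "computable G"
  shows "computable (\<lambda>v. F v mod G v)"
proof -
  have "computable (\<lambda>v. F v - G v * (F v div G v))" by (intro computable_intros assms)
  then show ?thesis by (simp add: minus_mult_div_eq_mod)
qed

section \<open>Lists coded as numbers\<close>

definition list_nth :: "nat \<Rightarrow> nat \<Rightarrow> nat" where
  "list_nth c i = pfst (rec_nat c (\<lambda>_ r. psnd (r - 1)) i - 1)"

text \<open>Counts the nonempty tails. A list is no longer than its code, so \<open>c\<close> bounds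
  the count, and past the end the iteration stays at 0, which codes both the empty list and the pair
  of zeros.\<close>

definition list_len :: "nat \<Rightarrow> nat" where
  "list_len c = (\<Sum>i<c. if 0 < rec_nat c (\<lambda>_ r. psnd (r - 1)) i then 1 else 0)"

lemma list_tails:
  "i \<le> length xs \<Longrightarrow> rec_nat (list_encode xs) (\<lambda>_ r. psnd (r - 1)) i = list_encode (drop i xs)"
proof (induction i)
  case (Suc i)
  then have "drop i xs = xs ! i # drop (Suc i) xs" by (simp add: Cons_nth_drop_Suc)
  with Suc show ?case by simp
qed simp

lemma list_tails_beyond:
  "length xs \<le> i \<Longrightarrow> rec_nat (list_encode xs) (\<lambda>_ r. psnd (r - 1)) i = 0"
proof (induction i rule: dec_induct)
  case base
  show ?case using list_tails[of "length xs" xs] by simp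
next
  case (step i)
  have "prod_encode (0, 0) = 0" by (simp add: prod_encode_def)
  then have "psnd 0 = 0" by (metis psnd_prod_encode)
  with step show ?case by simp
qed

lemma list_nth_encode [simp]: "i < length xs \<Longrightarrow> list_nth (list_encode xs) i = xs ! i"
  unfolding list_nth_def using Cons_nth_drop_Suc[of i xs] list_tails[of i xs]
  by (metis diff_Suc_1 less_imp_le list_encode.simps(2) pfst_prod_encode)

lemma length_le_list_encode: "length xs \<le> list_encode xs"
proof (induction xs)
  case (Cons x xs)
  then show ?case using le_prod_encode_2[of "list_encode xs" x] by simp
qed simp

lemma list_len_encode [simp]: "list_len (list_encode xs) = length xs"
proof -
  have pos: "0 < list_encode ys" if "ys \<noteq> []" for ys using that by (cases ys) auto
  have "0 < rec_nat (list_encode xs) (\<lambda>_ r. psnd (r - 1)) i \<longleftrightarrow> i < length xs" for i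
    using list_tails[of i xs] list_tails_beyond[of xs i] pos[of "drop i xs"] by (cases "i < length xs") auto
  then have "list_len (list_encode xs) = card {i. i < list_encode xs \<and> i < length xs}"
    unfolding list_len_def by (simp add: sum.If_cases Int_def lessThan_def)
  also have "{i. i < list_encode xs \<and> i < length xs} = {..<length xs}"
    using length_le_list_encode[of xs] by auto
  finally show ?thesis by simp
qed

lemma computable_list_nth [computable_intros]:
  assumes "computable F" "computable G"
  shows "computable (\<lambda>v. list_nth (F v) (G v))"
proof (rule computable_lift2[OF _ assms])
  show "computable (\<lambda>w. list_nth (pfst w) (psnd w))"
    unfolding list_nth_def
    by (intro computable_intros computable_rec_nat[where g = "\<lambda>_ r _. psnd (r - 1)"])
qed

lemma computable_list_len [computable_intros]:
  assumes "computable F"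
  shows "computable (\<lambda>v. list_len (F v))"
proof (rule computable_comp[OF _ assms])
  show "computable list_len"
    unfolding list_len_def
    by (intro computable_intros computable_rec_nat[where g = "\<lambda>_ r _. psnd (r - 1)"])
qed

text \<open>Codes grow at the head, so the recursion builds the list from its end: after
  \<open>i\<close> steps it holds the last \<open>i\<close> entries.\<close>

lemma computable_list_encode_upt [computable_intros]:
  assumes "computable b" "computable (\<lambda>w. f (pfst w) (psnd w))"
  shows "computable (\<lambda>v. list_encode (map (\<lambda>x. f x v) [0..<b v]))"
proof -
  have "computable (\<lambda>v. rec_nat 0 (\<lambda>n r. Suc (prod_encode (f (b v - Suc n) v, r))) (b v))"
    by (intro computable_rec_nat computable_intros assms computable_lift2[OF assms(2)] computable_comp[OF assms(1)])
  moreover have "rec_nat 0 (\<lambda>n r. Suc (prod_encode (f (k - Suc n) v, r))) i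
      = list_encode (map (\<lambda>x. f x v) [k - i..<k])" if "i \<le> k" for k i v
    using that
  proof (induction i)
    case (Suc i)
    then have "[k - Suc i..<k] = (k - Suc i) # [k - i..<k]"
      by (simp add: upt_rec[of "k - Suc i"] Suc_diff_Suc)
    with Suc show ?case by simp
  qed simp
  from this[OF order_refl] have "rec_nat 0 (\<lambda>n r. Suc (prod_encode (f (b v - Suc n) v, r))) (b v)
      = list_encode (map (\<lambda>x. f x v) [0..<b v])" for v by simp
  ultimately show ?thesis by simp
qed

lemma computable_list_encode_map:
  "\<forall>f\<in>set fs. computable f \<Longrightarrow> computable (\<lambda>v. list_encode (map (\<lambda>f. f v) fs))"
  by (induction fs) (auto intro!: computable_intros)

text \<open>Unbounded search; the existence hypothesis makes it total. It is what finds inverses in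
  multiplication tables later.\<close>

lemma computable_Least:
  assumes "decidable (\<lambda>w. P (pfst w) (psnd w))" and ex: "\<And>v. \<exists>x. P x v"
  shows "computable (\<lambda>v. LEAST x. P x v)"
proof -
  have "computable (\<lambda>w. if P (pfst w) (psnd w) then 0 else 1)"
    by (intro computable_intros assms(1))
  then obtain p where p: "reval p [w] (if P (pfst w) (psnd w) then 0 else 1)" for w
    unfolding computable_def by blast
  obtain q where q: "reval q [x, y] (prod_encode (x, y))" for x y
    using computable2_prod_encode unfolding computable2_def by blast
  have pq: "reval (Comp p [q]) [x, v] (if P x v then 0 else 1)" for x v
    using reval_Comp1[OF q p, of x v] by simp
  have "reval (Minim (Comp p [q])) [v] (LEAST x. P x v)" for v
  proof (rule reval.mn)
    show "reval (Comp p [q]) [LEAST x. P x v, v] 0"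
      using pq[of "LEAST x. P x v" v] LeastI_ex[OF ex[of v]] by simp
    show "\<forall>m<LEAST x. P x v. \<exists>r. reval (Comp p [q]) [m, v] r \<and> 0 < r"
    proof (intro allI impI)
      fix m assume "m < (LEAST x. P x v)"
      then have "\<not> P m v" by (rule not_less_Least)
      then show "\<exists>r. reval (Comp p [q]) [m, v] r \<and> 0 < r" using pq[of m v] by (intro exI[of _ 1]) simp
    qed
  qed
  then show ?thesis unfolding computable_def by blast
qed

section \<open>A universal predicate and the halting problem\<close>

text \<open>For the diagonal argument: a program cannot return both 0 and 1 on its own code.\<close>

lemma reval_deterministic: "reval p xs r \<Longrightarrow> reval p xs r' \<Longrightarrow> r = r'"
proof (induction arbitrary: r' rule: reval.induct)
  case (comp xs fs ys g r)
  from comp.prems obtain ys' where ys': "list_all2 (\<lambda>f y. reval f xs y) fs ys'" "reval g ys' r'"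
    by (auto elim: reval.cases)
  have "ys = ys'"
    using comp.IH(1) ys'(1) by (auto simp: list_all2_conv_all_nth intro!: nth_equalityI)
  with comp.IH(2) ys'(2) show ?case by blast
next
  case (prS f g n xs r s)
  from prS.prems obtain r2 where "reval (PrimRec f g) (n # xs) r2" "reval g (n # r2 # xs) r'"
    by (auto elim: reval.cases)
  with prS.IH show ?case by blast
next
  case (mn f n xs)
  from mn.prems have r': "reval f (r' # xs) 0" "\<forall>m<r'. \<exists>r. reval f (m # xs) r \<and> 0 < r"
    by (auto elim: reval.cases)
  show ?case
  proof (rule linorder_cases[of n r'])
    assume "n < r'"
    with r'(2) mn.IH(1) show ?thesis by fastforce
  next
    assume "r' < n"
    with mn.IH(2) r'(1) show ?thesis by fastforce
  qed
next
  case (pr0 f xs r g)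
  from pr0.prems have "reval f xs r'" by (auto elim: reval.cases)
  with pr0.IH show ?case by blast
qed (auto elim: reval.cases)

lemma decidable_mem_set_decode [computable_intros]:
  assumes "computable F" "computable G"
  shows "decidable (\<lambda>v. F v \<in> set_decode (G v))"
proof -
  have "decidable (\<lambda>v. G v div 2 ^ F v mod 2 = 1)" by (intro computable_intros assms)
  then show ?thesis by (simp add: set_decode_def odd_iff_mod_2_eq_one)
qed

section \<open>Codes of programs and of their derivations\<close>

fun recf_encode :: "recf \<Rightarrow> nat" where
  "recf_encode Zero = prod_encode (0, 0)"
| "recf_encode Succ = prod_encode (1, 0)"
| "recf_encode (Proj i) = prod_encode (2, i)"
| "recf_encode (Comp g fs) = prod_encode (3, prod_encode (recf_encode g, list_encode (map recf_encode fs)))"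
| "recf_encode (PrimRec f g) = prod_encode (4, prod_encode (recf_encode f, recf_encode g))"
| "recf_encode (Minim f) = prod_encode (5, recf_encode f)"

text \<open>
  A derivation is a set \<open>D\<close> of codes of tuples \<open>(h, p, xs, r)\<close> asserting that program \<open>p\<close> returns \<open>r\<close> on
  \<open>xs\<close>; the height \<open>h\<close> makes justification by other members of \<open>D\<close> well-founded. The bound \<open>B\<close> only serves
  to make all quantifiers bounded.
\<close>

definition derived :: "nat set \<Rightarrow> nat \<Rightarrow> nat \<Rightarrow> nat \<Rightarrow> nat \<Rightarrow> bool" where
  "derived D h p xs r \<longleftrightarrow> (\<exists>h'<h. prod_encode (h', prod_encode (p, prod_encode (xs, r))) \<in> D)"

text \<open>One disjunct per rule of \<open>reval\<close>, except that the two rules for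
  \<open>PrimRec\<close> start from the same program code. Subprograms and tails are bounded by the
  codes containing them; only intermediate results have no such bound and are bounded by
  \<open>B\<close>.\<close>

definition justified :: "nat \<Rightarrow> nat set \<Rightarrow> nat \<Rightarrow> nat \<Rightarrow> nat \<Rightarrow> nat \<Rightarrow> bool" where
  "justified B D h p xs r \<longleftrightarrow>
     (p = prod_encode (0, 0) \<and> r = 0)
   \<or> (p = prod_encode (1, 0) \<and> (\<exists>x<r. xs = Suc (prod_encode (x, 0)) \<and> r = Suc x))
   \<or> (\<exists>i<Suc p. p = prod_encode (2, i) \<and> i < list_len xs \<and> r = list_nth xs i)
   \<or> (\<exists>g<Suc p. \<exists>fs<Suc p. \<exists>ys<B. p = prod_encode (3, prod_encode (g, fs)) \<and>
        list_len ys = list_len fs \<and>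
        (\<forall>i<list_len fs. derived D h (list_nth fs i) xs (list_nth ys i)) \<and> derived D h g ys r)
   \<or> (\<exists>f<Suc p. \<exists>g<Suc p. \<exists>ys<xs. p = prod_encode (4, prod_encode (f, g)) \<and>
        xs = Suc (prod_encode (0, ys)) \<and> derived D h f ys r)
   \<or> (\<exists>f<Suc p. \<exists>g<Suc p. \<exists>ys<xs. \<exists>n<xs. \<exists>r'<B. p = prod_encode (4, prod_encode (f, g)) \<and>
        xs = Suc (prod_encode (Suc n, ys)) \<and> derived D h p (Suc (prod_encode (n, ys))) r' \<and>
        derived D h g (Suc (prod_encode (n, Suc (prod_encode (r', ys))))) r)
   \<or> (\<exists>f<Suc p. p = prod_encode (5, f) \<and> derived D h f (Suc (prod_encode (r, xs))) 0 \<and>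
        (\<forall>m<r. \<exists>r'<B. 0 < r' \<and> derived D h f (Suc (prod_encode (m, xs))) r'))"

definition derivation :: "nat \<Rightarrow> nat set \<Rightarrow> bool" where
  "derivation B D \<longleftrightarrow>
     (\<forall>h p xs r. prod_encode (h, prod_encode (p, prod_encode (xs, r))) \<in> D \<longrightarrow> justified B D h p xs r)"

lemma derived_mono: "derived D h p xs r \<Longrightarrow> D \<subseteq> D' \<Longrightarrow> h \<le> h' \<Longrightarrow> derived D' h' p xs r"
  unfolding derived_def by (meson order_less_le_trans subsetD)

lemma justified_mono:
  assumes "justified B D h p xs r" "B \<le> B'" "D \<subseteq> D'"
  shows "justified B' D' h p xs r"
proof -
  have d: "\<And>p xs r. derived D h p xs r \<Longrightarrow> derived D' h p xs r"
    using derived_mono assms(3) by blast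
  have B: "\<And>x. x < B \<Longrightarrow> x < B'" using assms(2) by simp
  show ?thesis using assms(1) unfolding justified_def
    by (elim disj_forward ex_forward conj_forward all_forward imp_forward) (assumption | erule d B)+
qed

text \<open>Induction on the height, since premises are derived at smaller heights. Every number
  codes a list, so argument lists met in \<open>D\<close> need no check; not every number codes a
  program, but only subprograms of \<open>p\<close> are ever met.\<close>

lemma derivation_sound:
  assumes D: "derivation B D"
  shows "prod_encode (h, prod_encode (recf_encode p, prod_encode (list_encode xs, r))) \<in> D \<Longrightarrow> reval p xs r"
proof (induction h arbitrary: p xs r rule: less_induct)
  case (less h)
  have J: "justified B D h (recf_encode p) (list_encode xs) r"
    using D less.prems unfolding derivation_def by blast
  have IH: "reval q ys s" if "derived D h (recf_encode q) (list_encode ys) s" for q ys s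
    using that less.IH unfolding derived_def by blast
  have dec: "\<exists>ys. c = list_encode ys" for c by (metis list_decode_inverse)
  show ?case
  proof (cases p)
    case Zero
    with J have "r = 0" by (simp add: justified_def)
    with Zero show ?thesis by (simp add: reval.zero)
  next
    case Succ
    with J obtain x where "list_encode xs = list_encode [x]" "r = Suc x" by (auto simp: justified_def)
    then show ?thesis using Succ by (simp only: list_encode_eq) (simp add: reval.succ)
  next
    case (Proj i)
    with J have "i < length xs" "r = xs ! i" by (auto simp: justified_def)
    with Proj show ?thesis by (simp add: reval.proj)
  next
    case (Comp g fs)
    with J obtain c where c: "list_len c = length fs"
      "\<forall>i<length fs. derived D h (list_nth (list_encode (map recf_encode fs)) i) (list_encode xs) (list_nth c i)"
      "derived D h (recf_encode g) c r"
      by (auto simp: justified_def)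
    obtain ys where "c = list_encode ys" using dec by blast
    with c have "length ys = length fs" "\<forall>i<length fs. reval (fs ! i) xs (ys ! i)" "reval g ys r"
      by (auto intro!: IH)
    with Comp show ?thesis by (auto intro!: reval.comp simp: list_all2_conv_all_nth)
  next
    case (PrimRec f g)
    with J consider c where "list_encode xs = Suc (prod_encode (0, c))" "derived D h (recf_encode f) c r"
      | c n r' where "list_encode xs = Suc (prod_encode (Suc n, c))"
        "derived D h (recf_encode p) (Suc (prod_encode (n, c))) r'"
        "derived D h (recf_encode g) (Suc (prod_encode (n, Suc (prod_encode (r', c))))) r"
      by (auto simp: justified_def)
    then show ?thesis
    proof cases
      case (1 c)
      then obtain ys where ys: "list_encode xs = list_encode (0 # ys)" "derived D h (recf_encode f) (list_encode ys) r"
        using dec[of c] by auto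
      then have "xs = 0 # ys" by (simp only: list_encode_eq)
      with IH[OF ys(2)] PrimRec show ?thesis by (simp add: reval.pr0)
    next
      case (2 c n r')
      then obtain ys where ys: "list_encode xs = list_encode (Suc n # ys)"
        "derived D h (recf_encode p) (list_encode (n # ys)) r'"
        "derived D h (recf_encode g) (list_encode (n # r' # ys)) r"
        using dec[of c] by auto
      then have "xs = Suc n # ys" by (simp only: list_encode_eq)
      with IH[OF ys(2)] IH[OF ys(3)] PrimRec show ?thesis by (auto intro: reval.prS)
    qed
  next
    case (Minim f)
    with J have "derived D h (recf_encode f) (list_encode (r # xs)) 0"
      "\<forall>m<r. \<exists>r'. 0 < r' \<and> derived D h (recf_encode f) (list_encode (m # xs)) r'"
      by (auto simp: justified_def)
    then have "reval f (r # xs) 0" "\<forall>m<r. \<exists>r'. reval f (m # xs) r' \<and> 0 < r'"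
      using IH by blast+
    with Minim show ?thesis by (simp add: reval.mn)
  qed
qed

definition derivable :: "nat \<Rightarrow> nat \<Rightarrow> nat \<Rightarrow> bool" where
  "derivable p xs r \<longleftrightarrow> (\<exists>B D h. finite D \<and> derivation B D \<and> derived D h p xs r)"

lemma derivation_Un:
  assumes "derivation B D" "derivation B' D'"
  shows "derivation (max B B') (D \<union> D')"
proof -
  have "justified (max B B') (D \<union> D') h p xs r" if "justified B D h p xs r \<or> justified B' D' h p xs r" for h p xs r
    using that by (auto intro: justified_mono)
  then show ?thesis using assms unfolding derivation_def by blast
qed

text \<open>A rule may have many premises, as for composition and minimization, and they must hold
  in one derivation. Justification is monotone in the bound and the set, so derivations are united
  and bounds and heights replaced by maxima.\<close>

lemma common_derivation:
  assumes "finite S" "\<forall>(p, xs, r)\<in>S. derivable p xs r"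
  shows "\<exists>B D h. finite D \<and> derivation B D \<and> (\<forall>(p, xs, r)\<in>S. derived D h p xs r)"
  using assms
proof (induction S rule: finite_induct)
  case empty
  have "derivation 0 {}" by (simp add: derivation_def)
  then show ?case by blast
next
  case (insert s S)
  obtain p xs r where s: "s = (p, xs, r)" using prod_cases3 by blast
  from insert obtain B D h where 1: "finite D" "derivation B D" "\<forall>(p, xs, r)\<in>S. derived D h p xs r"
    by auto
  from insert s obtain B' D' h' where 2: "finite D'" "derivation B' D'" "derived D' h' p xs r"
    unfolding derivable_def by auto
  have "\<forall>(p, xs, r)\<in>insert s S. derived (D \<union> D') (max h h') p xs r"
    using 1(3) 2(3) s
    by (auto intro: derived_mono[of D h _ _ _ "D \<union> D'"] derived_mono[of D' h' _ _ _ "D \<union> D'"])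
  then show ?case using 1 2 derivation_Un[of B D B' D'] by (intro exI conjI) auto
qed

lemma derivableI:
  assumes "finite S" "\<forall>(p, xs, r)\<in>S. derivable p xs r"
    and step: "\<And>D h. \<forall>(p, xs, r)\<in>S. derived D h p xs r \<Longrightarrow> \<exists>B. justified B D h p xs r"
  shows "derivable p xs r"
proof -
  obtain B D h where *: "finite D" "derivation B D" "\<forall>(p, xs, r)\<in>S. derived D h p xs r"
    using common_derivation[OF assms(1,2)] by blast
  obtain B' where "justified B' D h p xs r" using step[OF *(3)] by blast
  \<comment> \<open>The premises have heights below \<open>h\<close>, so the conclusion may enter at
    height exactly \<open>h\<close>.\<close>
  define D' where "D' = insert (prod_encode (h, prod_encode (p, prod_encode (xs, r)))) D"
  have "justified (max B B') D' h p xs r"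
    using \<open>justified B' D h p xs r\<close> by (rule justified_mono) (auto simp: D'_def)
  moreover have "justified (max B B') D' h' p' xs' r'" if "justified B D h' p' xs' r'" for h' p' xs' r'
    using that by (rule justified_mono) (auto simp: D'_def)
  ultimately have "derivation (max B B') D'"
    using *(2) unfolding derivation_def by (auto simp: D'_def)
  moreover have "finite D'" using * by (simp add: D'_def)
  moreover have "derived D' (Suc h) p xs r" unfolding derived_def D'_def by blast
  ultimately show ?thesis unfolding derivable_def by blast
qed

lemma derivation_complete: "reval p xs r \<Longrightarrow> derivable (recf_encode p) (list_encode xs) r"
proof (induction rule: reval.induct)
  case (zero xs)
  show ?case by (rule derivableI[of "{}"]) (auto simp: justified_def)
next
  case (succ x)
  show ?case by (rule derivableI[of "{}"]) (auto simp: justified_def)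
next
  case (proj i xs)
  show ?case
    by (rule derivableI[of "{}"]) (use proj le_prod_encode_2[of i 2] in \<open>auto simp: justified_def less_Suc_eq_le\<close>)
next
  case (comp xs fs ys g r)
  have len: "length fs = length ys" using comp.IH(1) by (rule list_all2_lengthD)
  define S where "S = insert (recf_encode g, list_encode ys, r)
    ((\<lambda>i. (recf_encode (fs ! i), list_encode xs, ys ! i)) ` {..<length fs})"
  show ?case
  proof (rule derivableI[of S])
    show "\<forall>(p, xs, r)\<in>S. derivable p xs r"
      using comp.IH len by (auto simp: S_def list_all2_conv_all_nth)
    fix D h assume *: "\<forall>(p, xs, r)\<in>S. derived D h p xs r"
    have "recf_encode g < Suc (recf_encode (Comp g fs))" "list_encode (map recf_encode fs) < Suc (recf_encode (Comp g fs))"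
      by (auto simp: less_Suc_eq_le intro: order_trans[OF le_prod_encode_1 le_prod_encode_2] order_trans[OF le_prod_encode_2 le_prod_encode_2])
    moreover have "\<forall>i<length fs. derived D h (recf_encode (fs ! i)) (list_encode xs) (ys ! i)"
      "derived D h (recf_encode g) (list_encode ys) r"
      using * by (auto simp: S_def)
    ultimately have "justified (Suc (list_encode ys)) D h (recf_encode (Comp g fs)) (list_encode xs) r"
      unfolding justified_def using len
      by - (rule disjI2, rule disjI2, rule disjI2, rule disjI1,
          rule exI[of _ "recf_encode g"], rule conjI, simp,
          rule exI[of _ "list_encode (map recf_encode fs)"], rule conjI, simp,
          rule exI[of _ "list_encode ys"], rule conjI, simp,
          auto)
    then show "\<exists>B. justified B D h (recf_encode (Comp g fs)) (list_encode xs) r" by blast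
  qed (auto simp: S_def)
next
  case (pr0 f xs r g)
  show ?case
  proof (rule derivableI[of "{(recf_encode f, list_encode xs, r)}"])
    fix D h assume *: "\<forall>(p, xs, r)\<in>{(recf_encode f, list_encode xs, r)}. derived D h p xs r"
    have "recf_encode f < Suc (recf_encode (PrimRec f g))" "recf_encode g < Suc (recf_encode (PrimRec f g))"
      "list_encode xs < list_encode (0 # xs)"
      by (auto simp: less_Suc_eq_le intro: le_prod_encode_2 order_trans[OF le_prod_encode_1 le_prod_encode_2] order_trans[OF le_prod_encode_2 le_prod_encode_2])
    then have "justified 0 D h (recf_encode (PrimRec f g)) (list_encode (0 # xs)) r"
      unfolding justified_def using *
      by - (rule disjI2, rule disjI2, rule disjI2, rule disjI2, rule disjI1,
          rule exI[of _ "recf_encode f"], rule conjI, simp,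
          rule exI[of _ "recf_encode g"], rule conjI, simp,
          rule exI[of _ "list_encode xs"], rule conjI, simp,
          auto)
    then show "\<exists>B. justified B D h (recf_encode (PrimRec f g)) (list_encode (0 # xs)) r" by blast
  qed (use pr0 in auto)
next
  case (prS f g n xs r s)
  define S where "S = {(recf_encode (PrimRec f g), list_encode (n # xs), r), (recf_encode g, list_encode (n # r # xs), s)}"
  show ?case
  proof (rule derivableI[of S])
    fix D h assume *: "\<forall>(p, xs, r)\<in>S. derived D h p xs r"
    have "recf_encode f < Suc (recf_encode (PrimRec f g))" "recf_encode g < Suc (recf_encode (PrimRec f g))"
      "list_encode xs < list_encode (Suc n # xs)" "n < list_encode (Suc n # xs)"
      using le_prod_encode_1[of "Suc n" "list_encode xs"]
      by (auto simp: less_Suc_eq_le intro: le_prod_encode_2 order_trans[OF le_prod_encode_1 le_prod_encode_2] order_trans[OF le_prod_encode_2 le_prod_encode_2])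
    then have "justified (Suc r) D h (recf_encode (PrimRec f g)) (list_encode (Suc n # xs)) s"
      unfolding justified_def using *
      by - (rule disjI2, rule disjI2, rule disjI2, rule disjI2, rule disjI2, rule disjI1,
          rule exI[of _ "recf_encode f"], rule conjI, simp,
          rule exI[of _ "recf_encode g"], rule conjI, simp,
          rule exI[of _ "list_encode xs"], rule conjI, simp,
          rule exI[of _ "n"], rule conjI, simp,
          rule exI[of _ "r"], rule conjI, simp,
          auto simp: S_def)
    then show "\<exists>B. justified B D h (recf_encode (PrimRec f g)) (list_encode (Suc n # xs)) s" by blast
  qed (use prS in \<open>auto simp: S_def\<close>)
next
  case (mn f n xs)
  then obtain q where q: "\<And>m. m < n \<Longrightarrow> derivable (recf_encode f) (list_encode (m # xs)) (q m) \<and> 0 < q m"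
    by metis
  define S where "S = insert (recf_encode f, list_encode (n # xs), 0)
    ((\<lambda>m. (recf_encode f, list_encode (m # xs), q m)) ` {..<n})"
  show ?case
  proof (rule derivableI[of S])
    show "\<forall>(p, xs, r)\<in>S. derivable p xs r" using mn q by (auto simp: S_def)
    fix D h assume *: "\<forall>(p, xs, r)\<in>S. derived D h p xs r"
    \<comment> \<open>The bound has to exceed all the positive values before the minimum; their sum
      serves.\<close>
    have "q m < Suc (\<Sum>m<n. q m)" if "m < n" for m
      using member_le_sum[of m "{..<n}" q] that by auto
    moreover have "recf_encode f < Suc (recf_encode (Minim f))" by (simp add: less_Suc_eq_le le_prod_encode_2)
    ultimately have "justified (Suc (\<Sum>m<n. q m)) D h (recf_encode (Minim f)) (list_encode xs) n"
      unfolding justified_def using * q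
      by (intro disjI2 exI[of _ "recf_encode f"] conjI) (auto simp: S_def)
    then show "\<exists>B. justified B D h (recf_encode (Minim f)) (list_encode xs) n" by blast
  qed (auto simp: S_def)
qed

text \<open>\<open>u\<close> encodes a bound and a derivation showing that the program with code \<open>e\<close> returns 0 on input \<open>e\<close>.\<close>

definition self_zero :: "nat \<Rightarrow> nat \<Rightarrow> bool" where
  "self_zero e u \<longleftrightarrow>
     (\<forall>n<psnd u. n \<in> set_decode (psnd u) \<longrightarrow> justified (pfst u) (set_decode (psnd u))
        (pfst n) (pfst (psnd n)) (pfst (psnd (psnd n))) (psnd (psnd (psnd n)))) \<and>
     (\<exists>h<psnd u. derived (set_decode (psnd u)) h e (Suc (prod_encode (e, 0))) 0)"

lemma decidable_self_zero: "decidable (\<lambda>w. self_zero (pfst w) (psnd w))"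
  unfolding self_zero_def justified_def derived_def by (intro computable_intros)

lemma set_decode_less: "n \<in> set_decode t \<Longrightarrow> n < t"
proof -
  assume "n \<in> set_decode t"
  then have "t div 2 ^ n \<noteq> 0" by (auto simp: set_decode_def intro!: Nat.gr0I)
  then have "2 ^ n \<le> t" by (meson div_less not_less)
  moreover have "n < 2 ^ n" by simp
  ultimately show "n < t" by (rule order_less_le_trans[rotated])
qed

lemma self_zero_iff: "(\<exists>u. self_zero (recf_encode p) u) \<longleftrightarrow> reval p [recf_encode p] 0"
proof -
  let ?e = "recf_encode p"
  have args: "Suc (prod_encode (?e, 0)) = list_encode [?e]" by simp
  have derivation_iff: "derivation B (set_decode t) \<longleftrightarrow>
      (\<forall>n<t. n \<in> set_decode t \<longrightarrow> justified B (set_decode t)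
        (pfst n) (pfst (psnd n)) (pfst (psnd (psnd n))) (psnd (psnd (psnd n))))"
    (is "_ \<longleftrightarrow> ?R") for B t
  proof
    show "derivation B (set_decode t) \<Longrightarrow> ?R"
      unfolding derivation_def by (metis prod_encode_pfst_psnd)
    show "?R \<Longrightarrow> derivation B (set_decode t)"
      unfolding derivation_def using set_decode_less by (metis pfst_prod_encode psnd_prod_encode)
  qed
  show ?thesis
  proof
    assume "\<exists>u. self_zero ?e u"
    then obtain u where "self_zero ?e u" ..
    then have "derivation (pfst u) (set_decode (psnd u))"
      and "\<exists>h. derived (set_decode (psnd u)) h ?e (list_encode [?e]) 0"
      unfolding self_zero_def args derivation_iff by auto
    then show "reval p [?e] 0" using derivation_sound unfolding derived_def by blast
  next
    assume "reval p [?e] 0"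
    from derivation_complete[OF this] obtain B D h
      where D: "finite D" "derivation B D" "derived D h ?e (list_encode [?e]) 0"
      unfolding derivable_def by blast
    then obtain h' where h': "prod_encode (h', prod_encode (?e, prod_encode (list_encode [?e], 0))) \<in> D"
      unfolding derived_def by blast
    let ?t = "set_encode D"
    have tri_pos: "0 < k \<Longrightarrow> 0 < triangle k" for k by (cases k) auto
    have t: "set_decode ?t = D" using D(1) by simp
    \<comment> \<open>\<open>self_zero\<close> bounds the height by the code of the set. As its
      second component is positive, the coded tuple exceeds its height \<open>h'\<close>, and
      members of a set lie below the code of the set.\<close>
    have pos: "0 < prod_encode (?e, prod_encode (list_encode [?e], 0))"
      using le_prod_encode_2[of "prod_encode (list_encode [?e], 0)" ?e] le_prod_encode_1[of "list_encode [?e]" 0] by simp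
    have "Suc h' \<le> prod_encode (h', prod_encode (?e, prod_encode (list_encode [?e], 0)))"
      using pos tri_pos by (simp add: prod_encode_def Suc_le_eq)
    also have "\<dots> < ?t" using h' set_decode_less t by metis
    finally have "Suc h' < ?t" .
    moreover have "derived D (Suc h') ?e (list_encode [?e]) 0"
      unfolding derived_def using h' by blast
    ultimately have "\<exists>h<?t. derived D h ?e (list_encode [?e]) 0" by blast
    then have "self_zero ?e (prod_encode (B, ?t))"
      unfolding self_zero_def args psnd_prod_encode pfst_prod_encode t
      using D(2) derivation_iff[of B ?t] unfolding t by blast
    then show "\<exists>u. self_zero ?e u" ..
  qed
qed

text \<open>Diagonal argument: run on its own code, a decider would return 0 exactly when it has to
  return 1.\<close>

lemma undecidable_self_zero: "\<not> decidable (\<lambda>e. \<exists>u. self_zero e u)"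
proof
  assume "decidable (\<lambda>e. \<exists>u. self_zero e u)"
  then obtain p where p: "\<And>n. reval p [n] (if \<exists>u. self_zero n u then 1 else 0)"
    unfolding decidable_def computable_def by blast
  show False
    using self_zero_iff[of p] p[of "recf_encode p"] reval_deterministic[of p "[recf_encode p]" 0 1]
    by (auto split: if_splits)
qed

text \<open>Taking the least code makes the halting time unique.\<close>

definition halts_at :: "nat \<Rightarrow> nat \<Rightarrow> bool" where
  "halts_at e u \<longleftrightarrow> self_zero e u \<and> (\<forall>u'<u. \<not> self_zero e u')"

lemma halts_at_unique: "halts_at e u \<Longrightarrow> halts_at e u' \<Longrightarrow> u = u'"
  unfolding halts_at_def by (meson linorder_neqE_nat)

lemma decidable_halts_at [computable_intros]:
  assumes "computable F" "computable G"
  shows "decidable (\<lambda>v. halts_at (F v) (G v))"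
proof (rule decidable_lift2[OF _ assms])
  show "decidable (\<lambda>w. halts_at (pfst w) (psnd w))"
    unfolding halts_at_def by (intro computable_intros decidable_lift2[OF decidable_self_zero])
qed

lemma undecidable_halts: "\<not> decidable (\<lambda>e. \<exists>u. halts_at e u)"
proof -
  have "(\<exists>u. halts_at e u) \<longleftrightarrow> (\<exists>u. self_zero e u)" for e
    unfolding halts_at_def using exists_least_iff[of "self_zero e"] by blast
  then show ?thesis using undecidable_self_zero by simp
qed

section \<open>Central extensions of finite lamplighter groups\<close>

declare add_bit_eq_xor [simp del] mult_bit_eq_and [simp del]

lemma bit_add_self [simp]: "x + x = (0::bit)"
  by (cases x) (auto simp: one_add_one)

text \<open>Functions on Z/m are kept as functions on the integers, so that shifting or reflecting
  the index needs no reduction.\<close>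

definition periodic :: "int \<Rightarrow> (int \<Rightarrow> bit) \<Rightarrow> bool" where
  "periodic m x \<longleftrightarrow> (\<forall>i. x (i mod m) = x i)"

lemma periodic_cong: "periodic m x \<Longrightarrow> a mod m = b mod m \<Longrightarrow> x a = x b"
  unfolding periodic_def by metis

lemma periodicI: "(\<And>a b. a mod m = b mod m \<Longrightarrow> x a = x b) \<Longrightarrow> periodic m x"
  unfolding periodic_def by (metis mod_mod_trivial)

lemma periodic_const: "periodic m (\<lambda>_. c)"
  by (simp add: periodic_def)

lemma periodic_shift: "periodic m x \<Longrightarrow> periodic m (\<lambda>i. x (i - k))"
  by (rule periodicI) (metis mod_diff_left_eq periodic_cong)

lemma periodic_reflect: "periodic m x \<Longrightarrow> periodic m (\<lambda>i. x (k - i))"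
  by (rule periodicI) (metis mod_diff_right_eq periodic_cong)

lemma periodic_add: "periodic m x \<Longrightarrow> periodic m y \<Longrightarrow> periodic m (\<lambda>i. x i + y i)"
  by (simp add: periodic_def)

lemma periodic_mult: "periodic m x \<Longrightarrow> periodic m y \<Longrightarrow> periodic m (\<lambda>i. x i * y i)"
  by (simp add: periodic_def)

lemma periodic_sum: "(\<And>j. j \<in> A \<Longrightarrow> periodic m (x j)) \<Longrightarrow> periodic m (\<lambda>i. \<Sum>j\<in>A. x j i)"
  by (simp add: periodic_def)

lemma periodic_residue: "periodic m (\<lambda>i. of_bool (m dvd i - r))"
  by (rule periodicI) (simp add: mod_eq_dvd_iff[symmetric])

lemma sum_periodic_shift:
  assumes "0 < m" "periodic m f"
  shows "(\<Sum>i\<in>{0..<m}. f (i - k)) = (\<Sum>i\<in>{0..<m}. f i)"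
proof (rule sum.reindex_bij_witness[of _ "\<lambda>j. (j + k) mod m" "\<lambda>i. (i - k) mod m"])
  show "f ((i - k) mod m) = f (i - k)" for i using assms(2) by (simp add: periodic_def)
qed (use assms(1) in \<open>auto simp: mod_simps\<close>)

lemma sum_residue:
  assumes "0 < m" "periodic m f"
  shows "(\<Sum>i\<in>{0..<m}. of_bool (m dvd i - r) * f i) = f r"
proof -
  have "m dvd i - r \<longleftrightarrow> i = r mod m" if "i \<in> {0..<m}" for i
    using that by (auto simp: mod_eq_dvd_iff[symmetric])
  then have "(\<Sum>i\<in>{0..<m}. of_bool (m dvd i - r) * f i) = (\<Sum>i\<in>{0..<m}. if i = r mod m then f i else 0)"
    by (intro sum.cong) auto
  also have "\<dots> = f (r mod m)" using assms(1) by (simp add: sum.delta)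
  finally show ?thesis using assms(2) by (simp add: periodic_def)
qed

definition form :: "int \<Rightarrow> (int \<Rightarrow> bit) \<Rightarrow> (int \<Rightarrow> bit) \<Rightarrow> (int \<Rightarrow> bit) \<Rightarrow> bit" where
  "form m s x y = (\<Sum>i\<in>{0..<m}. \<Sum>j\<in>{0..<m}. x i * y j * s (i - j))"

lemma form_add_left: "form m s (\<lambda>i. x i + x' i) y = form m s x y + form m s x' y"
  by (simp add: form_def sum.distrib distrib_right)

lemma form_add_right: "form m s x (\<lambda>i. y i + y' i) = form m s x y + form m s x y'"
  by (simp add: form_def sum.distrib distrib_right distrib_left)

lemma form_zero [simp]: "form m s (\<lambda>_. 0) y = 0" "form m s x (\<lambda>_. 0) = 0"
  by (simp_all add: form_def)

text \<open>The kernel of \<open>form\<close> depends only on \<open>i - j\<close>. Together with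
  biadditivity this invariance is the cocycle identity, hence associativity of
  \<open>lamp_group\<close>.\<close>

lemma form_shift:
  assumes "0 < m" "periodic m s" "periodic m x" "periodic m y"
  shows "form m s (\<lambda>i. x (i - k)) (\<lambda>i. y (i - k)) = form m s x y"
proof -
  have "form m s (\<lambda>i. x (i - k)) (\<lambda>i. y (i - k))
      = (\<Sum>i\<in>{0..<m}. \<Sum>j\<in>{0..<m}. x (i - k) * y j * s ((i - k) - j))"
    unfolding form_def
  proof (rule sum.cong[OF refl])
    fix i
    have "periodic m (\<lambda>j. x (i - k) * y j * s (i - k - j))"
      by (intro periodic_mult periodic_const assms periodic_reflect)
    from sum_periodic_shift[OF assms(1) this, of k]
    show "(\<Sum>j\<in>{0..<m}. x (i - k) * y (j - k) * s (i - j)) = (\<Sum>j\<in>{0..<m}. x (i - k) * y j * s (i - k - j))"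
      by simp
  qed
  also have "\<dots> = form m s x y"
    unfolding form_def
    by (rule sum_periodic_shift[OF assms(1), of "\<lambda>i. \<Sum>j\<in>{0..<m}. x i * y j * s (i - j)"])
      (intro periodic_sum periodic_mult periodic_const assms periodic_shift)
  finally show ?thesis .
qed

lemma form_residue:
  assumes "0 < m" "periodic m s"
  shows "form m s x (\<lambda>i. of_bool (m dvd i - k)) = (\<Sum>i\<in>{0..<m}. x i * s (i - k))"
  unfolding form_def
proof (rule sum.cong[OF refl])
  fix i
  have "(\<Sum>j\<in>{0..<m}. x i * of_bool (m dvd j - k) * s (i - j)) = (\<Sum>j\<in>{0..<m}. of_bool (m dvd j - k) * (x i * s (i - j)))"
    by (simp add: mult_ac)
  also have "\<dots> = x i * s (i - k)"
    by (rule sum_residue[OF assms(1)]) (intro periodic_mult periodic_const periodic_reflect assms)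
  finally show "(\<Sum>j\<in>{0..<m}. x i * of_bool (m dvd j - k) * s (i - j)) = x i * s (i - k)" .
qed

text \<open>An element is a position, a configuration of lamps and a central coordinate; \<open>form\<close> is the cocycle.\<close>

type_synonym lamps = "int \<times> (int \<Rightarrow> bit) \<times> bit"

definition lamp_group :: "int \<Rightarrow> (int \<Rightarrow> bit) \<Rightarrow> lamps monoid" where
  "lamp_group m s =
     \<lparr>carrier = {0..<m} \<times> {x. periodic m x} \<times> UNIV,
      mult = (\<lambda>(k, x, z) (l, y, w).
        ((k + l) mod m, \<lambda>i. x i + y (i - k), z + w + form m s x (\<lambda>i. y (i - k)))),
      one = (0, \<lambda>_. 0, 0)\<rparr>"

lemma carrier_lamp_group: "(k, x, z) \<in> carrier (lamp_group m s) \<longleftrightarrow> 0 \<le> k \<and> k < m \<and> periodic m x"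
  by (auto simp: lamp_group_def)

lemma mult_lamp_group: "(k, x, z) \<otimes>\<^bsub>lamp_group m s\<^esub> (l, y, w) =
    ((k + l) mod m, \<lambda>i. x i + y (i - k), z + w + form m s x (\<lambda>i. y (i - k)))"
  by (simp add: lamp_group_def)

lemma one_lamp_group: "\<one>\<^bsub>lamp_group m s\<^esub> = (0, \<lambda>_. 0, 0)"
  by (simp add: lamp_group_def)

lemma group_lamp_group:
  assumes m: "0 < m" and s: "periodic m s"
  shows "group (lamp_group m s)"
proof (rule groupI)
  let ?G = "lamp_group m s"
  fix g assume g: "g \<in> carrier ?G"
  obtain k x z where g_eq: "g = (k, x, z)" using prod_cases3 by blast
  with g have k: "0 \<le> k" "k < m" and x: "periodic m x" by (auto simp: carrier_lamp_group)
  show "\<one>\<^bsub>?G\<^esub> \<otimes>\<^bsub>?G\<^esub> g = g"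
    using k by (simp add: g_eq one_lamp_group mult_lamp_group)
  \<comment> \<open>The left inverse carries the same lamps shifted back by \<open>k\<close>; in
    characteristic 2 they cancel, and adding \<open>form m s ?y ?y\<close> to the central bit
    cancels the cocycle of the product.\<close>
  let ?y = "\<lambda>i. x (i + k)"
  have *: "x (i - - k mod m) = x (i + k)" for i
    by (rule periodic_cong[OF x]) (simp add: mod_simps)
  have "((- k) mod m, ?y, z + form m s ?y ?y) \<in> carrier ?G"
    using m periodic_shift[OF x, of "-k"] by (simp add: carrier_lamp_group)
  moreover have "((- k) mod m, ?y, z + form m s ?y ?y) \<otimes>\<^bsub>?G\<^esub> g = \<one>\<^bsub>?G\<^esub>"
    by (simp add: g_eq one_lamp_group mult_lamp_group * mod_simps algebra_simps)
  ultimately show "\<exists>h\<in>carrier ?G. h \<otimes>\<^bsub>?G\<^esub> g = \<one>\<^bsub>?G\<^esub>" by blast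
  fix h assume h: "h \<in> carrier ?G"
  obtain l y w where h_eq: "h = (l, y, w)" using prod_cases3 by blast
  with h have l: "0 \<le> l" "l < m" and y: "periodic m y" by (auto simp: carrier_lamp_group)
  show "g \<otimes>\<^bsub>?G\<^esub> h \<in> carrier ?G"
    using m x periodic_shift[OF y] by (simp add: g_eq h_eq mult_lamp_group carrier_lamp_group periodic_add)
  fix f assume f: "f \<in> carrier ?G"
  obtain n u v where f_eq: "f = (n, u, v)" using prod_cases3 by blast
  with f have u: "periodic m u" by (auto simp: carrier_lamp_group)
  have u_mod: "u (i - (k + l) mod m) = u (i - k - l)" for i
    by (rule periodic_cong[OF u]) (simp add: mod_simps algebra_simps)
  have "form m s y (\<lambda>i. u (i - l)) = form m s (\<lambda>i. y (i - k)) (\<lambda>i. u (i - k - l))"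
    using form_shift[OF m s y periodic_shift[OF u], of k l] by (simp add: algebra_simps)
  then show "g \<otimes>\<^bsub>?G\<^esub> h \<otimes>\<^bsub>?G\<^esub> f = g \<otimes>\<^bsub>?G\<^esub> (h \<otimes>\<^bsub>?G\<^esub> f)"
    by (simp add: g_eq h_eq f_eq mult_lamp_group u_mod form_add_left form_add_right mod_simps)
      (simp add: algebra_simps)
qed (use m in \<open>simp add: one_lamp_group carrier_lamp_group periodic_const\<close>)

section \<open>Values of words, and their form in lamp groups\<close>

lemma letter_val_closed:
  assumes "group G" "set gens \<subseteq> carrier G" "a < 2 * length gens"
  shows "letter_val G gens a \<in> carrier G"
proof -
  have "a div 2 < length gens" using assms(3) by (simp add: less_mult_imp_div_less mult.commute)
  then have "gens ! (a div 2) \<in> carrier G" using assms(2) nth_mem by blast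
  then show ?thesis using assms(1) by (simp add: letter_val_def group.inv_closed)
qed

lemma word_val_closed:
  assumes "group G" "set gens \<subseteq> carrier G" "valid_word gens w"
  shows "word_val G gens w \<in> carrier G"
proof -
  interpret group G by fact
  show ?thesis using assms(3)
    by (induction w) (auto simp: word_val_def valid_word_def letter_val_closed[OF assms(1,2)])
qed

lemma word_val_append:
  assumes "group G" "set gens \<subseteq> carrier G" "valid_word gens u" "valid_word gens v"
  shows "word_val G gens (u @ v) = word_val G gens u \<otimes>\<^bsub>G\<^esub> word_val G gens v"
proof -
  interpret group G by fact
  note v = word_val_closed[OF assms(1,2,4)]
  show ?thesis using assms(3)
  proof (induction u)
    case Nil
    then show ?case using v by (simp add: word_val_def)
  next
    case (Cons a u)
    then have "letter_val G gens a \<in> carrier G" "word_val G gens u \<in> carrier G" "valid_word gens u"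
      using letter_val_closed[OF assms(1,2)] word_val_closed[OF assms(1,2)] by (auto simp: valid_word_def)
    with Cons v show ?case by (simp add: word_val_def m_assoc)
  qed
qed

lemma hom_word_val:
  assumes "group G" "group H" "h \<in> hom G H" "set gens \<subseteq> carrier G" "valid_word gens w"
  shows "h (word_val G gens w) = word_val H (map h gens) w"
proof -
  interpret group_hom G H h using assms by (simp add: group_hom_def group_hom_axioms_def)
  show ?thesis using assms(5)
  proof (induction w)
    case (Cons a w)
    then have "letter_val G gens a \<in> carrier G" "word_val G gens w \<in> carrier G" "valid_word gens w" "a div 2 < length gens"
      using letter_val_closed[OF assms(1,4)] word_val_closed[OF assms(1,4)]
      by (auto simp: valid_word_def less_mult_imp_div_less mult.commute)
    moreover have "h (letter_val G gens a) = letter_val H (map h gens) a"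
      using hom_inv[OF subsetD[OF assms(4) nth_mem[OF calculation(4)]]] calculation(4)
      by (simp add: letter_val_def)
    ultimately show ?case using Cons by (simp add: word_val_def)
  qed (simp add: word_val_def)
qed

abbreviation step_elem :: lamps where "step_elem \<equiv> (1, \<lambda>_. 0, 0)"

definition toggle_elem :: "int \<Rightarrow> lamps" where "toggle_elem m = (0, \<lambda>i. of_bool (m dvd i), 0)"

text \<open>Letters 0 and 1 move the lamplighter by \<open>\<plusminus>1\<close>; the toggle is an involution, so letters 2 and 3 act alike.\<close>

definition position :: "(nat \<Rightarrow> nat) \<Rightarrow> nat \<Rightarrow> int" where
  "position f i = (\<Sum>j<i. if f j = 0 then 1 else if f j = 1 then - 1 else 0)"

lemma generators_closed:
  assumes "2 \<le> m"
  shows "step_elem \<in> carrier (lamp_group m s)" "toggle_elem m \<in> carrier (lamp_group m s)"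
  using assms periodic_residue[of m 0] by (auto simp: toggle_elem_def carrier_lamp_group periodic_const)

text \<open>Appending a toggle at position \<open>p\<close> adds the form of the lamps so far with
  the lamp at \<open>p\<close>, that is, one value of \<open>s\<close> for each earlier toggle. The
  cocycle of the toggle with itself is \<open>s 0\<close>, so \<open>s 0 = 0\<close> makes it an
  involution.\<close>

lemma word_val_lamp_group:
  assumes m: "2 \<le> m" and s: "periodic m s" and s0: "s 0 = 0" and f: "\<forall>i<n. f i < 4"
  shows "word_val (lamp_group m s) [step_elem, toggle_elem m] (map f [0..<n]) =
    (position f n mod m,
     \<lambda>q. \<Sum>i<n. of_bool (2 \<le> f i \<and> m dvd q - position f i),
     \<Sum>j<n. \<Sum>i<j. of_bool (2 \<le> f i \<and> 2 \<le> f j) * s (position f i - position f j))"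
  using f
proof (induction n)
  case 0
  show ?case by (simp add: word_val_def one_lamp_group position_def)
next
  case (Suc n)
  let ?G = "lamp_group m s" and ?gens = "[step_elem, toggle_elem m]"
  let ?w = "map f [0..<n]" and ?c = "f n"
  have m0: "0 < m" using m by simp
  interpret group ?G by (rule group_lamp_group[OF m0 s])
  have gens: "set ?gens \<subseteq> carrier ?G" using generators_closed[OF m] by simp
  have "word_val ?G ?gens (?w @ [?c]) = word_val ?G ?gens ?w \<otimes>\<^bsub>?G\<^esub> word_val ?G ?gens [?c]"
    using Suc.prems by (intro word_val_append is_group gens) (auto simp: valid_word_def)
  also have "word_val ?G ?gens [?c] = letter_val ?G ?gens ?c"
    using letter_val_closed[OF is_group gens, of ?c] Suc.prems by (simp add: word_val_def)
  finally have val: "word_val ?G ?gens (map f [0..<Suc n]) = word_val ?G ?gens ?w \<otimes>\<^bsub>?G\<^esub> letter_val ?G ?gens ?c"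
    by simp
  define X where "X = (\<lambda>q. \<Sum>i<n. of_bool (2 \<le> f i \<and> m dvd q - position f i) :: bit)"
  define Z where "Z = (\<Sum>j<n. \<Sum>i<j. of_bool (2 \<le> f i \<and> 2 \<le> f j) * s (position f i - position f j))"
  define p where "p = position f n"
  have IH: "word_val ?G ?gens ?w = (p mod m, X, Z)"
    using Suc unfolding X_def Z_def p_def by simp
  have new_p: "position f (Suc n) = p + (if ?c = 0 then 1 else if ?c = 1 then - 1 else 0)"
    by (simp add: p_def position_def)
  have new_X: "(\<lambda>q. \<Sum>i<Suc n. of_bool (2 \<le> f i \<and> m dvd q - position f i) :: bit)
      = (\<lambda>q. X q + of_bool (2 \<le> ?c \<and> m dvd q - p))"
    by (simp add: X_def p_def)
  have new_Z: "(\<Sum>j<Suc n. \<Sum>i<j. of_bool (2 \<le> f i \<and> 2 \<le> f j) * s (position f i - position f j))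
      = Z + (\<Sum>i<n. of_bool (2 \<le> f i \<and> 2 \<le> ?c) * s (position f i - p))"
    by (simp add: Z_def p_def)
  have inv_step: "inv\<^bsub>?G\<^esub> step_elem = ((- 1) mod m, \<lambda>_. 0, 0)"
    using m by (intro inv_equality) (auto simp: mult_lamp_group one_lamp_group carrier_lamp_group periodic_const mod_simps)
  have inv_toggle: "inv\<^bsub>?G\<^esub> toggle_elem m = toggle_elem m"
  proof (rule inv_equality)
    have "form m s (\<lambda>i. of_bool (m dvd i)) (\<lambda>i. of_bool (m dvd i - 0)) = (\<Sum>i\<in>{0..<m}. of_bool (m dvd i - 0) * s (i - 0))"
      by (subst form_residue[OF m0 s]) simp
    also have "\<dots> = s 0" by (subst sum_residue[OF m0]) (simp_all add: s)
    finally show "toggle_elem m \<otimes>\<^bsub>?G\<^esub> toggle_elem m = \<one>\<^bsub>?G\<^esub>"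
      by (simp add: toggle_elem_def mult_lamp_group one_lamp_group s0)
  qed (use generators_closed[OF m] in auto)
  consider "?c = 0" | "?c = 1" | "2 \<le> ?c" by linarith
  then show ?case
  proof cases
    case 1
    then show ?thesis
      unfolding val IH new_p new_X new_Z by (simp add: letter_val_def mult_lamp_group mod_simps)
  next
    case 2
    then show ?thesis
      unfolding val IH new_p new_X new_Z by (simp add: letter_val_def inv_step mult_lamp_group mod_simps)
  next
    case 3
    then have "?c = 2 \<or> ?c = 3" using Suc.prems by (auto dest: spec[of _ n])
    then have letter: "letter_val ?G ?gens ?c = toggle_elem m" by (auto simp: letter_val_def inv_toggle)
    have dvd: "m dvd i - p mod m \<longleftrightarrow> m dvd i - p" for i
      by (simp add: mod_eq_dvd_iff[symmetric])
    have "form m s X (\<lambda>i. of_bool (m dvd i - p)) = (\<Sum>i\<in>{0..<m}. X i * s (i - p))"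
      by (rule form_residue[OF m0 s])
    also have "\<dots> = (\<Sum>l<n. \<Sum>i\<in>{0..<m}. of_bool (m dvd i - position f l) * (of_bool (2 \<le> f l) * s (i - p)))"
      unfolding X_def sum_distrib_right 
      by (subst sum.swap) (simp only: of_bool_conj mult_ac)
    also have "\<dots> = (\<Sum>l<n. of_bool (2 \<le> f l) * s (position f l - p))"
      by (intro sum.cong refl sum_residue m0 periodic_mult periodic_const periodic_shift s)
    finally show ?thesis
      using 3 unfolding val IH new_p new_X new_Z letter
      by (simp add: toggle_elem_def mult_lamp_group dvd)
  qed
qed

lemma step_elem_pow:
  assumes "2 \<le> m"
  shows "step_elem [^]\<^bsub>lamp_group m s\<^esub> (n::nat) = (int n mod m, \<lambda>_. 0, 0)"
  using assms
  by (induction n) (simp_all add: nat_pow_def one_lamp_group mult_lamp_group mod_simps add.commute)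

text \<open>Conjugation by a power of the step moves the lamp to position \<open>n\<close> without
  central contribution. Its two products with the lamp at 0 differ only in the cocycle, which is
  \<open>s n\<close> in one order and \<open>s (- n)\<close> in the other.\<close>

lemma toggle_commute_iff:
  fixes n :: nat
  assumes m: "2 \<le> m" and s: "periodic m s"
  defines "G \<equiv> lamp_group m s"
  defines "t \<equiv> step_elem [^]\<^bsub>G\<^esub> n"
  defines "b \<equiv> t \<otimes>\<^bsub>G\<^esub> toggle_elem m \<otimes>\<^bsub>G\<^esub> inv\<^bsub>G\<^esub> t"
  shows "b \<otimes>\<^bsub>G\<^esub> toggle_elem m = toggle_elem m \<otimes>\<^bsub>G\<^esub> b \<longleftrightarrow> s (int n) = s (- int n)"
proof -
  have m0: "0 < m" using m by simp
  interpret group G unfolding G_def by (rule group_lamp_group[OF m0 s])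
  let ?b = "(0, \<lambda>i. of_bool (m dvd i - int n), 0) :: lamps"
  have t: "t = (int n mod m, \<lambda>_. 0, 0)" unfolding t_def G_def by (rule step_elem_pow[OF m])
  have t_in: "t \<in> carrier G" unfolding t_def by (rule nat_pow_closed) (simp add: G_def generators_closed[OF m])
  have b_in: "?b \<in> carrier G" using m0 by (simp add: G_def carrier_lamp_group periodic_residue)
  have "m dvd i - int n mod m \<longleftrightarrow> m dvd i - int n" for i
    by (simp add: mod_eq_dvd_iff[symmetric])
  then have "?b \<otimes>\<^bsub>G\<^esub> t = t \<otimes>\<^bsub>G\<^esub> toggle_elem m"
    unfolding t G_def toggle_elem_def by (simp add: mult_lamp_group)
  then have b: "b = ?b"
    unfolding b_def using t_in b_in by (metis inv_solve_right' m_closed)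
  have *: "form m s (\<lambda>i. of_bool (m dvd i - k)) (\<lambda>i. of_bool (m dvd i - l)) = s (k - l)" for k l
    by (subst form_residue[OF m0 s], subst sum_residue[OF m0]) (simp_all add: periodic_shift s)
  show ?thesis
    unfolding b using *[of "int n" 0] *[of 0 "int n"]
    by (simp add: G_def toggle_elem_def mult_lamp_group add.commute)
qed

text \<open>Mixed radix numbering of the elements: position modulo \<open>m\<close>, then the central bit, then the lamps in binary.\<close>

definition lamp_code :: "nat \<Rightarrow> nat \<Rightarrow> nat \<Rightarrow> (nat \<Rightarrow> nat) \<Rightarrow> nat" where
  "lamp_code m k z x = k + m * (z + 2 * (\<Sum>i<m. x i * 2 ^ i))"

definition lamp_bit :: "nat \<Rightarrow> nat \<Rightarrow> nat \<Rightarrow> nat" where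
  "lamp_bit m c i = c div (2 * m) div 2 ^ i mod 2"

text \<open>\<open>c div m\<close> still contains the lamps, but as an element of \<open>bit\<close>
  it is only its parity, the central digit.\<close>

definition lamp_decode :: "nat \<Rightarrow> nat \<Rightarrow> lamps" where
  "lamp_decode m c = (int (c mod m), \<lambda>i. of_nat (lamp_bit m c (nat (i mod int m))), of_nat (c div m))"

lemma sum_bits_eq_set_encode:
  assumes "\<And>i. i < m \<Longrightarrow> x i < 2"
  shows "(\<Sum>i<m. x i * 2 ^ i) = set_encode {i. i < m \<and> x i = (1::nat)}"
proof -
  have "(\<Sum>i<m. x i * 2 ^ i) = (\<Sum>i<m. if x i = 1 then 2 ^ i else 0)"
    using assms by (intro sum.cong) (auto simp: less_2_cases_iff)
  also have "\<dots> = set_encode {i. i < m \<and> x i = 1}"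
    by (simp add: set_encode_def sum.If_cases Int_def lessThan_def)
  finally show ?thesis .
qed

lemma lamp_bit_code:
  assumes "k < m" "z < 2" "\<And>i. i < m \<Longrightarrow> x i < 2" "j < m"
  shows "lamp_bit m (lamp_code m k z x) j = x j"
proof -
  have "lamp_code m k z x div (2 * m) = (\<Sum>i<m. x i * 2 ^ i)"
    using assms(1,2) by (simp add: lamp_code_def mult.commute[of 2] div_mult2_eq)
  moreover have "set_encode {i. i < m \<and> x i = 1} div 2 ^ j mod 2 = x j"
  proof -
    have "odd (set_encode {i. i < m \<and> x i = 1} div 2 ^ j) \<longleftrightarrow> j \<in> set_decode (set_encode {i. i < m \<and> x i = 1})"
      by (simp add: set_decode_def)
    also have "\<dots> \<longleftrightarrow> x j = 1" using assms(4) by (subst set_encode_inverse) auto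
    finally show ?thesis using assms(3)[OF assms(4)] by (auto simp: odd_iff_mod_2_eq_one less_2_cases_iff)
  qed
  ultimately show ?thesis
    unfolding lamp_bit_def using sum_bits_eq_set_encode[of m x, OF assms(3)] by simp
qed

lemma lamp_decode_code:
  assumes "k < m" "z < 2" "\<And>i. i < m \<Longrightarrow> x i < 2"
  shows "lamp_decode m (lamp_code m k z x) = (int k, \<lambda>i. of_nat (x (nat (i mod int m))), of_nat z)"
proof -
  have "nat (i mod int m) < m" for i using assms(1) by (simp add: nat_less_iff)
  moreover have "lamp_code m k z x mod m = k" "lamp_code m k z x div m = z + 2 * (\<Sum>i<m. x i * 2 ^ i)"
    using assms(1) by (simp_all add: lamp_code_def)
  ultimately show ?thesis
    using lamp_bit_code[OF assms] by (simp add: lamp_decode_def)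
qed

lemma sum_bits_less:
  assumes "\<And>i. i < m \<Longrightarrow> x i < (2::nat)"
  shows "(\<Sum>i<m. x i * 2 ^ i) < 2 ^ m"
  using assms
proof (induction m)
  case (Suc m)
  then have "(\<Sum>i<m. x i * 2 ^ i) < 2 ^ m" by simp
  moreover have "x m * 2 ^ m \<le> 2 ^ m" using Suc.prems[of m] by simp
  ultimately show ?case unfolding sum.lessThan_Suc power_Suc by linarith
qed simp

lemma lamp_code_less:
  assumes "k < m" "z < 2" "\<And>i. i < m \<Longrightarrow> x i < 2"
  shows "lamp_code m k z x < m * (2 * 2 ^ m)"
proof -
  have "z + 2 * (\<Sum>i<m. x i * 2 ^ i) + 1 \<le> 2 * 2 ^ m"
    using assms(2) sum_bits_less[of m x, OF assms(3)] by simp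
  then have "m * (z + 2 * (\<Sum>i<m. x i * 2 ^ i) + 1) \<le> m * (2 * 2 ^ m)" by (rule mult_le_mono2)
  then show ?thesis using assms(1) by (simp add: lamp_code_def)
qed

lemma bij_betw_lamp_decode:
  assumes m: "0 < m"
  shows "bij_betw (lamp_decode m) {..<m * (2 * 2 ^ m)} (carrier (lamp_group (int m) s))"
proof (rule bij_betw_imageI)
  show "inj_on (lamp_decode m) {..<m * (2 * 2 ^ m)}"
  proof (rule inj_onI)
    fix c d assume c: "c \<in> {..<m * (2 * 2 ^ m)}" and d: "d \<in> {..<m * (2 * 2 ^ m)}"
      and eq: "lamp_decode m c = lamp_decode m d"
    have parity: "(of_nat a :: bit) = of_nat b \<longleftrightarrow> even a = even b" for a b
      by (simp only: Z2.bit_eq_iff even_of_nat)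
    have mod: "c mod m = d mod m" and div: "even (c div m) = even (d div m)"
      using eq by (auto simp: lamp_decode_def parity)
    have "odd (c div (2 * m) div 2 ^ j) = odd (d div (2 * m) div 2 ^ j)" if "j < m" for j
    proof -
      have "(of_nat (lamp_bit m c (nat (int j mod int m))) :: bit) = of_nat (lamp_bit m d (nat (int j mod int m)))"
        using eq unfolding lamp_decode_def by (simp only: prod.inject fun_eq_iff)
      then show ?thesis using that by (simp add: parity lamp_bit_def even_mod_2_iff)
    qed
    \<comment> \<open>Equal images give equal binary digits at the \<open>m\<close> lamps; by the
      range of the codes all higher digits are 0, so the lamp parts agree as numbers.\<close>
    moreover have "\<not> odd (a div (2 * m) div 2 ^ j)" if "m \<le> j" "a < m * (2 * 2 ^ m)" for j a
    proof -
      have "a div (2 * m) < 2 ^ m"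
        using that(2) by (simp add: less_mult_imp_div_less mult_ac)
      also have "\<dots> \<le> 2 ^ j" using that(1) by simp
      finally show ?thesis by simp
    qed
    ultimately have "set_decode (c div (2 * m)) = set_decode (d div (2 * m))"
      using c d unfolding set_decode_def by (metis (mono_tags) lessThan_iff not_less)
    then have "c div m div 2 = d div m div 2"
      by (metis set_decode_inverse div_mult2_eq mult.commute)
    then have "c div m = d div m" using div by (metis dvd_mult_div_cancel odd_two_times_div_two_succ)
    with mod show "c = d" by (metis div_mult_mod_eq)
  qed
  show "lamp_decode m ` {..<m * (2 * 2 ^ m)} = carrier (lamp_group (int m) s)"
  proof
    show "lamp_decode m ` {..<m * (2 * 2 ^ m)} \<subseteq> carrier (lamp_group (int m) s)"
      using m by (auto simp: lamp_decode_def carrier_lamp_group periodic_def)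
    show "carrier (lamp_group (int m) s) \<subseteq> lamp_decode m ` {..<m * (2 * 2 ^ m)}"
    proof
      fix g assume g: "g \<in> carrier (lamp_group (int m) s)"
      obtain k x z where g_eq: "g = (k, x, z)" using prod_cases3 by blast
      with g have k: "0 \<le> k" "k < int m" and x: "periodic (int m) x" by (auto simp: carrier_lamp_group)
      define c where "c = lamp_code m (nat k) (of_bool (z = 1)) (\<lambda>i. of_bool (x (int i) = 1))"
      have "c < m * (2 * 2 ^ m)" unfolding c_def using k by (intro lamp_code_less) auto
      moreover have "lamp_decode m c = (int (nat k), \<lambda>i. of_nat (of_bool (x (int (nat (i mod int m))) = 1)), of_nat (of_bool (z = 1)))"
        unfolding c_def using k by (intro lamp_decode_code) auto
      moreover have "x (int (nat (i mod int m))) = x i" for i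
        using x m by (simp add: periodic_def)
      moreover have "(of_bool (b = 1) :: bit) = b" for b by (cases b) auto
      ultimately show "g \<in> lamp_decode m ` {..<m * (2 * 2 ^ m)}"
        using k by (intro image_eqI[of _ _ c]) (auto simp: g_eq)
    qed
  qed
qed

text \<open>The group law on codes, in natural number arithmetic so that computability can be read
  off; subtracting a residue modulo \<open>m\<close> becomes adding its complement to
  \<open>m\<close>.\<close>

definition lamp_mult :: "nat \<Rightarrow> (nat \<Rightarrow> nat) \<Rightarrow> nat \<Rightarrow> nat \<Rightarrow> nat" where
  "lamp_mult m s c d = lamp_code m ((c mod m + d mod m) mod m)
     ((c div m + d div m + (\<Sum>i<m. \<Sum>j<m. lamp_bit m c i * lamp_bit m d ((j + (m - c mod m)) mod m) * s ((i + (m - j)) mod m))) mod 2)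
     (\<lambda>i. (lamp_bit m c i + lamp_bit m d ((i + (m - c mod m)) mod m)) mod 2)"

lemma lamp_mult_less: "0 < m \<Longrightarrow> lamp_mult m s c d < m * (2 * 2 ^ m)"
  unfolding lamp_mult_def by (rule lamp_code_less) auto

lemma lamp_decode_mult:
  assumes m: "0 < m"
  shows "lamp_decode m (lamp_mult m s c d) =
    lamp_decode m c \<otimes>\<^bsub>lamp_group (int m) (\<lambda>i. of_nat (s (nat (i mod int m))))\<^esub> lamp_decode m d"
proof -
  have mod2: "(of_nat (n mod 2) :: bit) = of_nat n" for n by (simp only: Z2.bit_eq_iff even_of_nat even_mod_2_iff)
  have sub: "nat ((int i - int k) mod int m) = (i + (m - k)) mod m" if "k \<le> m" for i k
  proof -
    have "(int i - int k) mod int m = (int i - int k + int m) mod int m" by simp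
    also have "int i - int k + int m = int (i + (m - k))" using that by simp
    finally show ?thesis by (metis nat_int zmod_int)
  qed
  have sub': "nat ((i - int k) mod int m) = (nat (i mod int m) + (m - k)) mod m" if "k \<le> m" for i k
    using sub[OF that, of "nat (i mod int m)"] m by (simp add: mod_simps)
  have sums: "(\<Sum>i\<in>{0..<int m}. f i) = (\<Sum>i<m. f (int i))" for f :: "int \<Rightarrow> bit"
    by (rule sum.reindex_bij_witness[of _ int nat]) auto
  define K where "K = c mod m"
  have K: "K \<le> m" "K < m" using m by (simp_all add: K_def less_imp_le)
  have "lamp_decode m (lamp_mult m s c d) =
      (int ((K + d mod m) mod m),
       \<lambda>i. of_nat ((lamp_bit m c (nat (i mod int m)) + lamp_bit m d ((nat (i mod int m) + (m - K)) mod m)) mod 2),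
       of_nat ((c div m + d div m + (\<Sum>i<m. \<Sum>j<m. lamp_bit m c i * lamp_bit m d ((j + (m - K)) mod m) * s ((i + (m - j)) mod m))) mod 2))"
    unfolding lamp_mult_def K_def by (rule lamp_decode_code) (use m in auto)
  also have "\<dots> = ((int K + int (d mod m)) mod int m,
      \<lambda>i. of_nat (lamp_bit m c (nat (i mod int m))) + of_nat (lamp_bit m d (nat ((i - int K) mod int m))),
      of_nat (c div m) + of_nat (d div m) +
        (\<Sum>i<m. \<Sum>j<m. of_nat (lamp_bit m c (nat (int i mod int m))) *
          of_nat (lamp_bit m d (nat ((int j - int K) mod int m))) * of_nat (s (nat ((int i - int j) mod int m)))))"
    unfolding mod2 sub'[OF K(1)] of_nat_add of_nat_sum of_nat_mult zmod_int
    by (auto simp: sub mod_simps intro!: sum.cong)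
  also have "\<dots> = lamp_decode m c \<otimes>\<^bsub>lamp_group (int m) (\<lambda>i. of_nat (s (nat (i mod int m))))\<^esub> lamp_decode m d"
    unfolding lamp_decode_def mult_lamp_group form_def sums K_def ..
  finally show ?thesis .
qed

section \<open>Holes at halting times and the word problem\<close>

definition hole :: "nat \<Rightarrow> nat \<Rightarrow> nat" where
  "hole e u = 2 ^ e * (4 * u + 1)"

text \<open>A multiple of \<open>2 ^ (e + 2)\<close>, so the pattern of the other marks survives,
  and about twice \<open>hole e u\<close>: the representatives of the hole nearest to 0,
  \<open>2 ^ e * (4 * u + 1)\<close> and \<open>- (2 ^ e * (4 * u + 7))\<close>, both exceed
  \<open>u\<close> in absolute value.\<close>

definition hole_period :: "nat \<Rightarrow> nat \<Rightarrow> nat" where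
  "hole_period e u = 2 ^ (e + 2) * (2 * u + 2)"

definition marks :: "nat \<Rightarrow> int \<Rightarrow> bit" where
  "marks e d = of_bool (d mod 2 ^ (e + 2) = 2 ^ e \<and>
     \<not> (\<exists>u. halts_at e u \<and> d mod int (hole_period e u) = int (hole e u)))"

definition period :: "nat \<Rightarrow> nat" where
  "period e = (if \<exists>u. halts_at e u then hole_period e (THE u. halts_at e u) else 2 ^ (e + 2))"

lemma period_halts: "halts_at e u \<Longrightarrow> period e = hole_period e u"
  unfolding period_def using halts_at_unique by (metis the_equality)

lemma period_dvd: "2 ^ (e + 2) dvd period e"
  by (auto simp: period_def hole_period_def)

lemma period_pos: "0 < period e"
  by (auto simp: period_def hole_period_def)

lemma period_ge: "2 ^ (e + 2) \<le> period e"
  using period_dvd period_pos by (rule dvd_imp_le)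

lemma period_ge_2: "2 \<le> int (period e)"
proof -
  have "(2::nat) ^ 1 \<le> 2 ^ (e + 2)" by (rule power_increasing) auto
  from order_trans[OF this period_ge] show ?thesis by simp
qed

lemma periodic_marks: "periodic (int (period e)) (marks e)"
proof (rule periodicI)
  fix a b assume ab: "a mod int (period e) = b mod int (period e)"
  have "int (2 ^ (e + 2)) dvd int (period e)" using period_dvd int_dvd_int_iff by blast
  then have "a mod int (2 ^ (e + 2)) = b mod int (2 ^ (e + 2))"
    using ab by (metis mod_mod_cancel)
  moreover have "a mod int (hole_period e u) = b mod int (hole_period e u)" if "halts_at e u" for u
    using ab period_halts[OF that] by simp
  ultimately show "marks e a = marks e b" unfolding marks_def by auto
qed

lemma marks_0: "marks e 0 = 0"
  by (simp add: marks_def)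

lemma residue_iff: "(d::int) mod 2 ^ (e + 2) = 2 ^ e \<longleftrightarrow> (\<exists>k. d = 2 ^ e * (4 * k + 1))"
proof
  assume "d mod 2 ^ (e + 2) = 2 ^ e"
  then have "d = 2 ^ (e + 2) * (d div 2 ^ (e + 2)) + 2 ^ e" by (metis mult_div_mod_eq)
  then show "\<exists>k. d = 2 ^ e * (4 * k + 1)"
    by (intro exI[of _ "d div 2 ^ (e + 2)"]) (simp add: algebra_simps)
next
  assume "\<exists>k. d = 2 ^ e * (4 * k + 1)"
  then obtain k where "d = 2 ^ e + 2 ^ (e + 2) * k" by (auto simp: algebra_simps)
  then show "d mod 2 ^ (e + 2) = 2 ^ e" by (simp add: mod_pos_pos_trivial)
qed

lemma power2_odd_unique:
  fixes x y :: int
  assumes "2 ^ a * x = 2 ^ b * y" "odd x" "odd y"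
  shows "a = b"
  using assms
proof (induction a arbitrary: b)
  case 0
  then show ?case by (cases b) auto
next
  case (Suc a)
  then show ?case by (cases b) auto
qed

text \<open>By the 2-adic valuation only the factor \<open>e\<close> itself could mark the hole, and
  there it is removed. The negative is marked nowhere because its odd part is 3 modulo 4.\<close>

lemma marks_hole:
  assumes "halts_at e u"
  shows "marks e' (int (hole e u)) = 0" "marks e' (- int (hole e u)) = 0"
proof -
  have less: "hole e u < hole_period e u" by (simp add: hole_def hole_period_def)
  have "\<not> (- int (hole e u)) mod 2 ^ (e' + 2) = 2 ^ e'"
  proof
    assume "(- int (hole e u)) mod 2 ^ (e' + 2) = 2 ^ e'"
    then obtain k where "- int (hole e u) = 2 ^ e' * (4 * k + 1)" unfolding residue_iff ..
    then have k: "2 ^ e * (- (4 * int u + 1)) = 2 ^ e' * (4 * k + 1)"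
      by (simp add: hole_def algebra_simps)
    then have "e = e'" by (rule power2_odd_unique) auto
    with k have "- (4 * int u + 1) = 4 * k + 1" by simp
    then show False by presburger
  qed
  then show "marks e' (- int (hole e u)) = 0" by (simp add: marks_def)
  have "e = e'" if "int (hole e u) mod 2 ^ (e' + 2) = 2 ^ e'"
  proof -
    from that obtain k where "int (hole e u) = 2 ^ e' * (4 * k + 1)" unfolding residue_iff ..
    then have "2 ^ e * (4 * int u + 1) = 2 ^ e' * (4 * k + 1)" by (simp add: hole_def algebra_simps)
    then show ?thesis by (rule power2_odd_unique) auto
  qed
  moreover have "int (hole e u) mod int (hole_period e u) = int (hole e u)"
    using less by simp
  ultimately show "marks e' (int (hole e u)) = 0" using assms unfolding marks_def by auto
qed

section \<open>Deciding whether a word is trivial\<close>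

definition ups :: "(nat \<Rightarrow> nat) \<Rightarrow> nat \<Rightarrow> nat" where
  "ups f i = (\<Sum>j<i. if f j = 0 then 1 else 0)"

definition downs :: "(nat \<Rightarrow> nat) \<Rightarrow> nat \<Rightarrow> nat" where
  "downs f i = (\<Sum>j<i. if f j = 1 then 1 else 0)"

lemma position_eq: "position f i = int (ups f i) - int (downs f i)"
  by (induction i) (auto simp: position_def ups_def downs_def)

lemma ups_downs_le: "ups f i + downs f i \<le> i"
  by (induction i) (auto simp: ups_def downs_def)

text \<open>A decidable substitute for \<open>marks e\<close> at the difference
  \<open>a - b\<close>: signed numbers are given as differences of naturals, and halting times are
  searched only up to \<open>n\<close>.\<close>

definition marked :: "nat \<Rightarrow> nat \<Rightarrow> nat \<Rightarrow> nat \<Rightarrow> bool" where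
  "marked n e a b \<longleftrightarrow> a mod 2 ^ (e + 2) = (b + 2 ^ e) mod 2 ^ (e + 2) \<and>
     \<not> (\<exists>u<Suc n. halts_at e u \<and> a mod hole_period e u = (b + hole e u) mod hole_period e u)"

lemma diff_mod_eq_iff:
  assumes "r < m"
  shows "(int a - int b) mod int m = int r \<longleftrightarrow> a mod m = (b + r) mod m"
proof -
  have "(int a - int b) mod int m = int r \<longleftrightarrow> (int a - int b) mod int m = int r mod int m"
    using assms by simp
  also have "\<dots> \<longleftrightarrow> int a mod int m = int (b + r) mod int m"
    by (simp add: mod_eq_dvd_iff algebra_simps)
  also have "\<dots> \<longleftrightarrow> a mod m = (b + r) mod m" by (metis nat_int zmod_int)
  finally show ?thesis .
qed

lemma small_mod_cases:
  fixes d m :: int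
  assumes "\<bar>d\<bar> < m"
  shows "d mod m = d \<or> d mod m = d + m"
proof (cases "0 \<le> d")
  case False
  then have "(d + m) mod m = d + m" using assms by (intro mod_pos_pos_trivial) auto
  then show ?thesis by simp
qed (use assms in simp)

lemma late_hole_invisible:
  assumes "\<bar>d\<bar> \<le> int n" "n < u"
  shows "d mod int (hole_period e u) \<noteq> int (hole e u)"
proof -
  define c where "c = 2 ^ e * (4 * u + 7)"
  have "4 * u + 1 \<le> hole e u" "4 * u + 7 \<le> c"
    using mult_le_mono1[of 1 "2 ^ e" "4 * u + 1"] mult_le_mono1[of 1 "2 ^ e" "4 * u + 7"]
    by (simp_all add: hole_def c_def)
  moreover have "hole_period e u = hole e u + c"
    by (simp add: hole_def hole_period_def c_def algebra_simps)
  ultimately show ?thesis using assms small_mod_cases[of d "int (hole_period e u)"] by linarith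
qed

lemma marks_eq_marked:
  assumes "\<bar>int a - int b\<bar> \<le> int n"
  shows "marks e (int a - int b) = of_bool (marked n e a b)"
proof -
  have "(2::nat) ^ e < 2 ^ (e + 2)" by simp
  from diff_mod_eq_iff[OF this, of a b]
  have 1: "(int a - int b) mod 2 ^ (e + 2) = 2 ^ e \<longleftrightarrow> a mod 2 ^ (e + 2) = (b + 2 ^ e) mod 2 ^ (e + 2)"
    by simp
  have "hole e u < hole_period e u" for u by (simp add: hole_def hole_period_def)
  note 2 = diff_mod_eq_iff[OF this, of a b]
  have "halts_at e u \<and> (int a - int b) mod int (hole_period e u) = int (hole e u) \<longleftrightarrow>
      u < Suc n \<and> halts_at e u \<and> a mod hole_period e u = (b + hole e u) mod hole_period e u" for u
    using late_hole_invisible[OF assms, of u e] 2[of u] by (metis not_less_eq)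
  with 1 show ?thesis unfolding marks_def marked_def by simp
qed

text \<open>The nearest members of the residue class of \<open>2 ^ e\<close> are
  \<open>2 ^ e\<close> and \<open>- 3 * 2 ^ e\<close>, both out of reach. So a word of length
  \<open>n\<close> has to be tested in finitely many factors only.\<close>

lemma marks_eq_0:
  assumes "\<bar>d\<bar> \<le> int n" "n < e"
  shows "marks e d = 0"
proof -
  have "n < 2 ^ e" using assms(2) less_exp[of e] by linarith
  then have n: "int n < 2 ^ e" by (metis of_nat_less_iff of_nat_numeral of_nat_power)
  have M: "(2::int) ^ (e + 2) = 4 * 2 ^ e" by simp
  have "d mod (4 * 2 ^ e) = d \<or> d mod (4 * 2 ^ e) = d + 4 * 2 ^ e"
    by (rule small_mod_cases) (use n assms(1) in linarith)
  then have "d mod 2 ^ (e + 2) \<noteq> 2 ^ e" unfolding M using n assms(1) by linarith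
  then show ?thesis by (simp add: marks_def)
qed

text \<open>
  For a word with letters \<open>f 0, \<dots>, f (n - 1)\<close>: it returns to position 0, toggles every lamp an even number of
  times, and all central coordinates vanish; those with index above \<open>n\<close> do so automatically.
\<close>

definition trivial_word :: "(nat \<Rightarrow> nat) \<Rightarrow> nat \<Rightarrow> bool" where
  "trivial_word f n \<longleftrightarrow> ups f n = downs f n \<and>
     (\<forall>i<n. 2 \<le> f i \<longrightarrow>
        (\<Sum>l<n. if 2 \<le> f l \<and> ups f l + downs f i = ups f i + downs f l then 1 else 0) mod 2 = (0::nat)) \<and>
     (\<forall>e<Suc n. (\<Sum>j<n. \<Sum>i<j. if 2 \<le> f i \<and> 2 \<le> f j \<and>
        marked n e (ups f i + downs f j) (ups f j + downs f i) then 1 else 0) mod 2 = (0::nat))"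

lemma decidable_trivial_word: "decidable (\<lambda>c. trivial_word (list_nth c) (list_len c))"
  unfolding trivial_word_def marked_def ups_def downs_def hole_def hole_period_def
  by (intro computable_intros)

lemma bit_sum_eq_0_iff:
  "(\<Sum>i\<in>A. of_bool (P i) :: bit) = 0 \<longleftrightarrow> (\<Sum>i\<in>A. if P i then 1 else 0) mod 2 = (0::nat)"
proof -
  have "(\<Sum>i\<in>A. of_bool (P i) :: bit) = of_nat (\<Sum>i\<in>A. if P i then 1 else 0)"
    unfolding of_nat_sum by (intro sum.cong) auto
  moreover have "(of_nat n :: bit) = 0 \<longleftrightarrow> n mod 2 = 0" for n
    unfolding even_iff_mod_2_eq_zero[symmetric] by (simp only: Z2.bit_eq_iff even_of_nat even_zero simp_thms)
  ultimately show ?thesis by (simp only:)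
qed

lemma bit_double_sum_eq_0_iff:
  "(\<Sum>j<n::nat. \<Sum>i<j. of_bool (P i j) :: bit) = 0 \<longleftrightarrow> (\<Sum>j<n. \<Sum>i<j. if P i j then 1 else 0) mod 2 = (0::nat)"
proof -
  have "(\<Sum>j<n. \<Sum>i<j. of_bool (P i j) :: bit) = of_nat (\<Sum>j<n. \<Sum>i<j. if P i j then 1 else 0)"
    unfolding of_nat_sum by (intro sum.cong) auto
  moreover have "(of_nat n :: bit) = 0 \<longleftrightarrow> n mod 2 = 0" for n
    unfolding even_iff_mod_2_eq_zero[symmetric] by (simp only: Z2.bit_eq_iff even_of_nat even_zero simp_thms)
  ultimately show ?thesis by (simp only:)
qed

text \<open>Indices are grouped by position, and each group contributes an even multiple of one
  value. Applied to lamps: toggles that cancel over the integers cancel modulo every period.\<close>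

lemma even_fibres_sum_zero:
  fixes g :: "int \<Rightarrow> bit"
  assumes "finite A" "\<And>i. i \<in> A \<Longrightarrow> even (card {l\<in>A. p l = p i})"
  shows "(\<Sum>l\<in>A. g (p l)) = 0"
proof -
  have "(\<Sum>l\<in>A. g (p l)) = (\<Sum>y\<in>p ` A. \<Sum>l\<in>{l\<in>A. p l = y}. g (p l))"
    by (rule sum.image_gen[OF assms(1)])
  also have "\<dots> = 0"
  proof (rule sum.neutral, rule ballI)
    fix y assume "y \<in> p ` A"
    then obtain i where i: "i \<in> A" "y = p i" by blast
    have "(\<Sum>l\<in>{l\<in>A. p l = y}. g (p l)) = of_nat (card {l\<in>A. p l = y}) * g y" by simp
    moreover have "(of_nat (card {l\<in>A. p l = y}) :: bit) = 0"
      using assms(2)[OF i(1)] i(2) by (simp only: Z2.bit_eq_iff even_of_nat even_zero)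
    ultimately show "(\<Sum>l\<in>{l\<in>A. p l = y}. g (p l)) = 0" by simp
  qed
  finally show ?thesis .
qed

lemma trivial_word_iff:
  assumes f: "\<forall>i<n. f i < 4"
  shows "(\<forall>e. word_val (lamp_group (int (period e)) (marks e)) [step_elem, toggle_elem (int (period e))]
      (map f [0..<n]) = \<one>\<^bsub>lamp_group (int (period e)) (marks e)\<^esub>) \<longleftrightarrow> trivial_word f n"
proof -
  let ?p = "position f"
  have p_le: "\<bar>?p i\<bar> \<le> int i" for i
    using ups_downs_le[of f i] unfolding position_eq by linarith
  have diff_le: "\<bar>?p i - ?p j\<bar> \<le> int n" if "i \<le> j" "j \<le> n" for i j
  proof -
    have "\<bar>?p i - ?p j\<bar> \<le> int (j - i)" using that(1)
    proof (induction j rule: dec_induct)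
      case (step j)
      have "\<bar>?p (Suc j) - ?p j\<bar> \<le> 1" by (simp add: position_def)
      with step show ?case by linarith
    qed simp
    with that show ?thesis by linarith
  qed
  have pos_eq: "?p l = ?p i \<longleftrightarrow> ups f l + downs f i = ups f i + downs f l" for i l
    unfolding position_eq by linarith
  have marks_p: "marks e (?p i - ?p j) = of_bool (marked n e (ups f i + downs f j) (ups f j + downs f i))"
    if "i \<le> j" "j \<le> n" for e i j
  proof -
    have "?p i - ?p j = int (ups f i + downs f j) - int (ups f j + downs f i)"
      unfolding position_eq by simp
    with diff_le[OF that] show ?thesis by (simp only: marks_eq_marked)
  qed
  have pairs: "(\<Sum>j<n. \<Sum>i<j. of_bool (2 \<le> f i \<and> 2 \<le> f j) * marks e (?p i - ?p j)) = 0 \<longleftrightarrow>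
      (\<Sum>j<n. \<Sum>i<j. if 2 \<le> f i \<and> 2 \<le> f j \<and>
        marked n e (ups f i + downs f j) (ups f j + downs f i) then 1 else 0) mod 2 = (0::nat)" for e
    unfolding bit_double_sum_eq_0_iff[symmetric]
    by (intro arg_cong[where f = "\<lambda>x. x = 0"] sum.cong) (auto simp: marks_p)
  have val: "word_val (lamp_group (int (period e)) (marks e)) [step_elem, toggle_elem (int (period e))]
      (map f [0..<n]) = \<one>\<^bsub>lamp_group (int (period e)) (marks e)\<^esub> \<longleftrightarrow>
      int (period e) dvd ?p n \<and> (\<forall>q. (\<Sum>i<n. of_bool (2 \<le> f i \<and> int (period e) dvd q - ?p i) :: bit) = 0) \<and>
      (\<Sum>j<n. \<Sum>i<j. of_bool (2 \<le> f i \<and> 2 \<le> f j) * marks e (?p i - ?p j)) = 0" for e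
    unfolding word_val_lamp_group[OF period_ge_2 periodic_marks marks_0 f] one_lamp_group
    by (simp add: fun_eq_iff dvd_eq_mod_eq_0)
  have count: "(\<Sum>l<n. if 2 \<le> f l \<and> ups f l + downs f i = ups f i + downs f l then 1 else 0 :: nat)
      = card {l \<in> {l. l < n \<and> 2 \<le> f l}. ?p l = ?p i}" for i
    unfolding pos_eq by (simp add: sum.If_cases Int_def lessThan_def conj_assoc)
  show ?thesis
  proof
    assume *: "\<forall>e. word_val (lamp_group (int (period e)) (marks e)) [step_elem, toggle_elem (int (period e))]
      (map f [0..<n]) = \<one>\<^bsub>lamp_group (int (period e)) (marks e)\<^esub>"
    \<comment> \<open>The period of factor \<open>n\<close> exceeds \<open>2 * n\<close>, so this
      single factor reads positions and lamps as exactly as the integers do; the other factors see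
      reductions of them.\<close>
    have "n < 2 ^ n" by (rule less_exp)
    moreover have "(2::nat) ^ (n + 2) = 4 * 2 ^ n" by simp
    ultimately have "2 * n < 2 ^ (n + 2)" by linarith
    then have big: "2 * n < period n" using period_ge[of n] by linarith
    have eq: "int (period n) dvd ?p i - ?p l \<longleftrightarrow> ?p l = ?p i" if "i \<le> n" "l \<le> n" for i l
    proof -
      have "\<bar>?p i - ?p l\<bar> < int (period n)" using p_le[of i] p_le[of l] that big by linarith
      then have "int (period n) dvd ?p i - ?p l \<longleftrightarrow> ?p i - ?p l = 0"
        using dvd_imp_le_int[of "?p i - ?p l" "int (period n)"] by (cases "?p i - ?p l = 0") auto
      then show ?thesis by auto
    qed
    have "int (period n) dvd ?p n - ?p 0" using * val[of n] by (simp add: position_def)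
    then have "?p n = 0" using eq[of n 0] by (simp add: position_def)
    then have "ups f n = downs f n" unfolding position_eq by simp
    moreover have "(\<Sum>l<n. if 2 \<le> f l \<and> ups f l + downs f i = ups f i + downs f l then 1 else 0) mod 2 = (0::nat)"
      if "i < n" for i
    proof -
      have "(\<Sum>l<n. of_bool (2 \<le> f l \<and> int (period n) dvd ?p i - ?p l) :: bit) = 0"
        using * val[of n] by blast
      also have "(\<Sum>l<n. of_bool (2 \<le> f l \<and> int (period n) dvd ?p i - ?p l) :: bit)
          = (\<Sum>l<n. of_bool (2 \<le> f l \<and> ups f l + downs f i = ups f i + downs f l))"
        using that by (intro sum.cong) (auto simp: eq pos_eq)
      finally show ?thesis unfolding bit_sum_eq_0_iff .
    qed
    ultimately show "trivial_word f n"
      using * val pairs unfolding trivial_word_def by blast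
  next
    assume triv: "trivial_word f n"
    show "\<forall>e. word_val (lamp_group (int (period e)) (marks e)) [step_elem, toggle_elem (int (period e))]
      (map f [0..<n]) = \<one>\<^bsub>lamp_group (int (period e)) (marks e)\<^esub>"
    proof
      fix e
      have "?p n = 0" using triv unfolding trivial_word_def position_eq by simp
      moreover have "(\<Sum>i<n. of_bool (2 \<le> f i \<and> int (period e) dvd q - ?p i) :: bit) = 0" for q
      proof -
        have "(\<Sum>i<n. of_bool (2 \<le> f i \<and> int (period e) dvd q - ?p i) :: bit)
            = (\<Sum>i\<in>{l. l < n \<and> 2 \<le> f l}. of_bool (int (period e) dvd q - ?p i))"
          by (intro sum.mono_neutral_cong_right) auto
        also have "\<dots> = 0"
          by (rule even_fibres_sum_zero[where g = "\<lambda>y. of_bool (int (period e) dvd q - y)"])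
            (use triv in \<open>auto simp: trivial_word_def count even_iff_mod_2_eq_zero\<close>)
        finally show ?thesis .
      qed
      moreover have "(\<Sum>j<n. \<Sum>i<j. of_bool (2 \<le> f i \<and> 2 \<le> f j) * marks e (?p i - ?p j)) = 0"
      proof (cases "e \<le> n")
        case True
        then show ?thesis using triv unfolding pairs trivial_word_def by simp
      next
        case False
        then have "marks e (?p i - ?p j) = 0" if "i < j" "j < n" for i j
          using marks_eq_0[OF diff_le[of i j]] that by simp
        then show ?thesis by (intro sum.neutral ballI) simp
      qed
      ultimately show "word_val (lamp_group (int (period e)) (marks e)) [step_elem, toggle_elem (int (period e))]
      (map f [0..<n]) = \<one>\<^bsub>lamp_group (int (period e)) (marks e)\<^esub>" unfolding val by simp
    qed
  qed
qed

section \<open>Multiplication tables and the main theorem\<close>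

text \<open>The group laws hold because they hold after the injective \<open>d\<close>. It serves
  twice: for moving a group onto the natural numbers and for recognizing a multiplication table as a
  group.\<close>

lemma group_pullback:
  assumes H: "group H" and bij: "bij_betw d (carrier K) (carrier H)"
    and mult: "\<And>a b. a \<in> carrier K \<Longrightarrow> b \<in> carrier K \<Longrightarrow> a \<otimes>\<^bsub>K\<^esub> b \<in> carrier K"
    and dmult: "\<And>a b. a \<in> carrier K \<Longrightarrow> b \<in> carrier K \<Longrightarrow> d (a \<otimes>\<^bsub>K\<^esub> b) = d a \<otimes>\<^bsub>H\<^esub> d b"
    and one: "\<one>\<^bsub>K\<^esub> \<in> carrier K" "d \<one>\<^bsub>K\<^esub> = \<one>\<^bsub>H\<^esub>"
  shows "group K" "d \<in> iso K H"
proof -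
  interpret group H by (rule H)
  have inj: "d a = d b \<Longrightarrow> a = b" if "a \<in> carrier K" "b \<in> carrier K" for a b
    using bij that by (meson bij_betw_def inj_onD)
  have im: "d a \<in> carrier H" if "a \<in> carrier K" for a
    using bij that by (meson bij_betwE)
  show "group K"
  proof (rule groupI)
    fix a assume a: "a \<in> carrier K"
    show "\<one>\<^bsub>K\<^esub> \<otimes>\<^bsub>K\<^esub> a = a" using a by (intro inj) (simp_all add: mult dmult one im)
    have "inv\<^bsub>H\<^esub> d a \<in> d ` carrier K" using bij a im by (simp add: bij_betw_def)
    then obtain b where b: "b \<in> carrier K" "d b = inv\<^bsub>H\<^esub> d a" by force
    then have "b \<otimes>\<^bsub>K\<^esub> a = \<one>\<^bsub>K\<^esub>" using a by (intro inj) (simp_all add: mult dmult one im)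
    with b show "\<exists>b\<in>carrier K. b \<otimes>\<^bsub>K\<^esub> a = \<one>\<^bsub>K\<^esub>" by blast
    fix b c assume "b \<in> carrier K" "c \<in> carrier K"
    with a show "a \<otimes>\<^bsub>K\<^esub> b \<otimes>\<^bsub>K\<^esub> c = a \<otimes>\<^bsub>K\<^esub> (b \<otimes>\<^bsub>K\<^esub> c)"
      by (intro inj) (simp_all add: mult dmult im m_assoc)
  qed (use mult one in auto)
  show "d \<in> iso K H" using bij im dmult by (auto simp: iso_def hom_def)
qed

text \<open>The group sought and the finite quotients in \<open>residually_finite\<close> have to
  live on \<open>nat\<close>, whereas the factors and their product do not.\<close>

lemma countable_group_iso_nat:
  assumes H: "group H" and "countable (carrier H)"
  shows "\<exists>(K :: nat monoid) d. group K \<and> d \<in> iso K H"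
proof -
  interpret group H by (rule H)
  obtain f :: "'a \<Rightarrow> nat" where f: "inj_on f (carrier H)" using assms(2) by (auto simp: countable_def)
  define g where "g = inv_into (carrier H) f"
  define K where "K = \<lparr>carrier = f ` carrier H, mult = (\<lambda>a b. f (g a \<otimes>\<^bsub>H\<^esub> g b)), one = f \<one>\<^bsub>H\<^esub>\<rparr>"
  have gf: "g (f x) = x" if "x \<in> carrier H" for x unfolding g_def using f that by simp
  have "bij_betw g (carrier K) (carrier H)"
    unfolding K_def g_def using f by (simp add: bij_betw_inv_into inj_on_imp_bij_betw)
  moreover have "a \<otimes>\<^bsub>K\<^esub> b \<in> carrier K" "g (a \<otimes>\<^bsub>K\<^esub> b) = g a \<otimes>\<^bsub>H\<^esub> g b"
    if "a \<in> carrier K" "b \<in> carrier K" for a b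
    using that by (auto simp: K_def gf)
  moreover have "\<one>\<^bsub>K\<^esub> \<in> carrier K" "g \<one>\<^bsub>K\<^esub> = \<one>\<^bsub>H\<^esub>" by (auto simp: K_def gf)
  ultimately have "group K" "g \<in> iso K H" by (auto intro!: group_pullback[OF H])
  then show ?thesis by blast
qed

text \<open>Gives countability of a finitely generated subgroup, as an image of a set of
  words.\<close>

lemma generate_subset_word_val:
  assumes G: "group G" and gens: "set gens \<subseteq> carrier G"
  shows "generate G (set gens) \<subseteq> word_val G gens ` {w. valid_word gens w}"
proof
  interpret group G by (rule G)
  have letter: "letter_val G gens a \<in> word_val G gens ` {w. valid_word gens w}" if "a < 2 * length gens" for a
    using letter_val_closed[OF G gens that] that
    by (intro image_eqI[of _ _ "[a]"]) (auto simp: word_val_def valid_word_def)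
  fix x assume "x \<in> generate G (set gens)"
  then show "x \<in> word_val G gens ` {w. valid_word gens w}"
  proof induction
    case one
    show ?case by (intro image_eqI[of _ _ "[]"]) (auto simp: word_val_def valid_word_def)
  next
    case (incl h)
    then obtain i where "i < length gens" "h = gens ! i" by (auto simp: in_set_conv_nth)
    then show ?case using letter[of "2 * i"] by (simp add: letter_val_def)
  next
    case (inv h)
    then obtain i where "i < length gens" "h = gens ! i" by (auto simp: in_set_conv_nth)
    then show ?case using letter[of "2 * i + 1"] by (simp add: letter_val_def)
  next
    case (eng h1 h2)
    then obtain u v where "valid_word gens u" "valid_word gens v" "h1 = word_val G gens u" "h2 = word_val G gens v"
      by blast
    then show ?case using word_val_append[OF G gens, of u v]
      by (intro image_eqI[of _ _ "u @ v"]) (auto simp: valid_word_def)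
  qed
qed

lemma hom_conj_pow:
  fixes n :: nat
  assumes "group G" "group H" "f \<in> hom G H" "t \<in> carrier G" "a \<in> carrier G"
  shows "f (t [^]\<^bsub>G\<^esub> n \<otimes>\<^bsub>G\<^esub> a \<otimes>\<^bsub>G\<^esub> inv\<^bsub>G\<^esub> (t [^]\<^bsub>G\<^esub> n)) =
    f t [^]\<^bsub>H\<^esub> n \<otimes>\<^bsub>H\<^esub> f a \<otimes>\<^bsub>H\<^esub> inv\<^bsub>H\<^esub> (f t [^]\<^bsub>H\<^esub> n)"
proof -
  interpret group_hom G H f using assms by (simp add: group_hom_def group_hom_axioms_def)
  show ?thesis using assms(4,5) by (simp add: hom_nat_pow)
qed

section \<open>Tables of the lamp groups without holes\<close>

abbreviation factor :: "nat \<Rightarrow> lamps monoid" where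
  "factor e \<equiv> lamp_group (int (period e)) (marks e)"

lemma group_factor: "group (factor e)"
  using group_lamp_group[OF _ periodic_marks] period_pos by simp

definition table_order :: "nat \<Rightarrow> nat" where
  "table_order e = 2 ^ (e + 2) * (2 * 2 ^ 2 ^ (e + 2))"

definition table_mult :: "nat \<Rightarrow> nat \<Rightarrow> nat \<Rightarrow> nat" where
  "table_mult e = lamp_mult (2 ^ (e + 2)) (\<lambda>r. if r = 2 ^ e then 1 else 0)"

text \<open>Computable in \<open>e\<close> because it ignores halting: it is the table of the factor
  that would occur if program \<open>e\<close> never halted.\<close>

definition table :: "nat \<Rightarrow> nat list list" where
  "table e = map (\<lambda>i. map (\<lambda>j. table_mult e i j) [0..<table_order e]) [0..<table_order e]"

definition table_marks :: "nat \<Rightarrow> int \<Rightarrow> bit" where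
  "table_marks e d = of_bool (d mod 2 ^ (e + 2) = 2 ^ e)"

lemma periodic_table_marks: "periodic (2 ^ (e + 2)) (table_marks e)"
  by (simp add: periodic_def table_marks_def)

abbreviation table_lamps :: "nat \<Rightarrow> lamps monoid" where
  "table_lamps e \<equiv> lamp_group (2 ^ (e + 2)) (table_marks e)"

lemma group_table_lamps: "group (table_lamps e)"
  by (rule group_lamp_group[OF _ periodic_table_marks]) simp

lemma computable_table_order [computable_intros]:
  assumes "computable F"
  shows "computable (\<lambda>v. table_order (F v))"
  unfolding table_order_def by (intro computable_intros assms)

lemma computable_table_mult:
  assumes "computable F" "computable A" "computable B"
  shows "computable (\<lambda>v. table_mult (F v) (A v) (B v))"
proof (rule computable_lift3[OF _ assms])
  show "computable (\<lambda>w. table_mult (pfst w) (pfst (psnd w)) (psnd (psnd w)))"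
    unfolding table_mult_def lamp_mult_def lamp_code_def lamp_bit_def by (intro computable_intros)
qed

lemma computable_table: "computable (\<lambda>e. list_encode (map list_encode (table e)))"
  unfolding table_def map_map comp_def
  by (intro computable_intros computable_table_mult)

lemma length_table: "length (table e) = table_order e"
  by (simp add: table_def)

lemma table_nth: "i < table_order e \<Longrightarrow> j < table_order e \<Longrightarrow> table e ! i ! j = table_mult e i j"
  by (simp add: table_def)

lemma table_mult_less: "table_mult e i j < table_order e"
  unfolding table_mult_def table_order_def by (rule lamp_mult_less) simp

lemma bij_betw_table_decode: "bij_betw (lamp_decode (2 ^ (e + 2))) {..<table_order e} (carrier (table_lamps e))"
  using bij_betw_lamp_decode[of "2 ^ (e + 2)" "table_marks e"] by (simp add: table_order_def)

lemma table_decode_mult: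
  "lamp_decode (2 ^ (e + 2)) (table_mult e i j) =
    lamp_decode (2 ^ (e + 2)) i \<otimes>\<^bsub>table_lamps e\<^esub> lamp_decode (2 ^ (e + 2)) j"
proof -
  have eq: "nat (i mod 2 ^ (e + 2)) = 2 ^ e \<longleftrightarrow> i mod 2 ^ (e + 2) = 2 ^ e" for i :: int
    by (metis nat_int of_nat_numeral of_nat_power int_nat_eq pos_mod_sign zero_less_numeral zero_less_power)
  have "(\<lambda>i. of_nat (if nat (i mod int (2 ^ (e + 2))) = 2 ^ e then 1 else 0)) = table_marks e"
    unfolding table_marks_def of_nat_power of_nat_numeral eq by (auto simp: fun_eq_iff)
  then show ?thesis
    using lamp_decode_mult[of "2 ^ (e + 2)" "\<lambda>r. if r = 2 ^ e then 1 else 0" i j]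
    unfolding table_mult_def by simp
qed

lemma table_decode_0: "lamp_decode (2 ^ (e + 2)) 0 = \<one>\<^bsub>table_lamps e\<^esub>"
  by (simp add: lamp_decode_def lamp_bit_def one_lamp_group)

lemma table_order_pos: "0 < table_order e"
  by (simp add: table_order_def)

lemma table_one_table: "table_one (table e) = 0"
proof -
  interpret group "table_lamps e" by (rule group_table_lamps)
  have id: "table_mult e 0 x = x \<and> table_mult e x 0 = x" if "x < table_order e" for x
  proof -
    have x: "lamp_decode (2 ^ (e + 2)) x \<in> carrier (table_lamps e)"
      using bij_betw_table_decode[of e] that by (meson bij_betwE lessThan_iff)
    have "lamp_decode (2 ^ (e + 2)) (table_mult e 0 x) = lamp_decode (2 ^ (e + 2)) x"
      "lamp_decode (2 ^ (e + 2)) (table_mult e x 0) = lamp_decode (2 ^ (e + 2)) x"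
      unfolding table_decode_mult table_decode_0 by (rule l_one[OF x], rule r_one[OF x])
    then show ?thesis
      using bij_betw_imp_inj_on[OF bij_betw_table_decode[of e]] that table_mult_less
      by (meson inj_onD lessThan_iff)
  qed
  show ?thesis unfolding table_one_def length_table
  proof (rule the_equality)
    show "0 < table_order e \<and> (\<forall>x<table_order e. table e ! 0 ! x = x \<and> table e ! x ! 0 = x)"
      using id table_order_pos by (simp add: table_nth)
    fix a assume "a < table_order e \<and> (\<forall>x<table_order e. table e ! a ! x = x \<and> table e ! x ! a = x)"
    then show "a = 0" using id[of a] table_order_pos by (metis table_nth)
  qed
qed

lemma table_group_simps:
  "carrier (table_group (table e)) = {..<table_order e}"
  "\<one>\<^bsub>table_group (table e)\<^esub> = 0"
  "i < table_order e \<Longrightarrow> j < table_order e \<Longrightarrow> i \<otimes>\<^bsub>table_group (table e)\<^esub> j = table_mult e i j"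
  by (simp_all add: table_group_def length_table table_one_table table_nth)

lemma group_table: "group (table_group (table e))"
  and iso_table_decode: "lamp_decode (2 ^ (e + 2)) \<in> iso (table_group (table e)) (table_lamps e)"
proof -
  have *: "bij_betw (lamp_decode (2 ^ (e + 2))) (carrier (table_group (table e))) (carrier (table_lamps e))"
    using bij_betw_table_decode by (simp add: table_group_simps)
  note pull = group_pullback[OF group_table_lamps *, unfolded table_group_simps]
  show "group (table_group (table e))" "lamp_decode (2 ^ (e + 2)) \<in> iso (table_group (table e)) (table_lamps e)"
    by (rule pull; simp only: lessThan_iff table_group_simps table_mult_less table_decode_mult table_decode_0 table_order_pos)+
qed

lemma valid_marked_table:
  "length fl = length gens \<Longrightarrow> \<forall>y\<in>set fl. y < table_order e \<Longrightarrow> valid_marked gens (table e) fl"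
  unfolding valid_marked_def using group_table by (auto simp: length_table) (auto simp: table_def)

text \<open>In the mixed radix numbering position 1 is the number 1, and the lamp at 0 has weight
  \<open>2 * m\<close> with \<open>m = 2 ^ (e + 2)\<close>.\<close>

definition step_code :: "nat \<Rightarrow> nat" where "step_code e = 1"
definition toggle_code :: "nat \<Rightarrow> nat" where "toggle_code e = 2 ^ (e + 2) * 2"

lemma step_code:
  "step_code e < table_order e" "lamp_decode (2 ^ (e + 2)) (step_code e) = step_elem"
proof -
  have m: "(1::nat) < 2 ^ (e + 2)" by (rule one_less_power) auto
  have c: "lamp_code (2 ^ (e + 2)) 1 0 (\<lambda>_. 0) = step_code e" by (simp add: lamp_code_def step_code_def)
  show "step_code e < table_order e"
    unfolding c[symmetric] table_order_def using m by (intro lamp_code_less) auto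
  show "lamp_decode (2 ^ (e + 2)) (step_code e) = step_elem"
    unfolding c[symmetric] using m by (subst lamp_decode_code) auto
qed

lemma toggle_code:
  "toggle_code e < table_order e" "lamp_decode (2 ^ (e + 2)) (toggle_code e) = toggle_elem (2 ^ (e + 2))"
proof -
  have "(\<Sum>i<2 ^ (e + 2). (if i = 0 then 1 else 0) * (2::nat) ^ i) = (\<Sum>i<2 ^ (e + 2). if i = (0::nat) then 1 else 0)"
    by (intro sum.cong) auto
  then have c: "lamp_code (2 ^ (e + 2)) 0 0 (\<lambda>i. if i = 0 then 1 else 0) = toggle_code e"
    by (simp add: lamp_code_def toggle_code_def sum.delta)
  show "toggle_code e < table_order e"
    unfolding c[symmetric] table_order_def by (intro lamp_code_less) auto
  have *: "nat (i mod 2 ^ (e + 2)) = 0 \<longleftrightarrow> 2 ^ (e + 2) dvd i" for i :: int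
    by (metis dvd_eq_mod_eq_0 nat_0_iff nat_0 pos_mod_sign order_antisym zero_less_numeral zero_less_power)
  have "lamp_decode (2 ^ (e + 2)) (toggle_code e) =
      (int 0, \<lambda>i. of_nat (if nat (i mod int (2 ^ (e + 2))) = 0 then 1 else 0), of_nat 0)"
    unfolding c[symmetric] by (rule lamp_decode_code) auto
  then show "lamp_decode (2 ^ (e + 2)) (toggle_code e) = toggle_elem (2 ^ (e + 2))"
    unfolding toggle_elem_def of_nat_power of_nat_numeral * by (auto simp: fun_eq_iff)
qed

text \<open>Each \<open>g\<close> is a fixed word in \<open>X\<close>, evaluated in the tables
  uniformly in \<open>e\<close>. The family \<open>S\<close> may be undecidable: the function is
  total, but its values are prescribed only at indices occurring in \<open>S\<close>.\<close>

lemma computable_hom_values: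
  assumes G: "group G"
    and hom: "\<And>e h. (e, h) \<in> S \<Longrightarrow> h \<in> hom G (table_group (table e))"
    and X: "X \<subseteq> carrier G"
    and vals: "\<And>x. x \<in> X \<Longrightarrow> \<exists>\<psi>. computable \<psi> \<and> (\<forall>(e, h)\<in>S. h x = \<psi> e)"
    and g: "g \<in> generate G X"
  shows "\<exists>\<psi>. computable \<psi> \<and> (\<forall>(e, h)\<in>S. h g = \<psi> e)"
proof -
  interpret group G by (rule G)
  have gh: "group_hom G (table_group (table e)) h" if "(e, h) \<in> S" for e h
    using hom[OF that] G group_table by (simp add: group_hom_def group_hom_axioms_def)
  have less: "h x < table_order e" if "(e, h) \<in> S" "x \<in> carrier G" for e h x
    using group_hom.hom_closed[OF gh[OF that(1)] that(2)] by (simp add: table_group_simps)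
  show ?thesis using g
  proof induction
    case one
    have "h \<one>\<^bsub>G\<^esub> = 0" if "(e, h) \<in> S" for e h
      using group_hom.hom_one[OF gh[OF that]] by (simp add: table_group_simps)
    then show ?case by (intro exI[of _ "\<lambda>_. 0"]) (auto intro: computable_intros)
  next
    case (incl x)
    then show ?case by (rule vals)
  next
    case (inv x)
    then obtain \<psi> where \<psi>: "computable \<psi>" "\<And>e h. (e, h) \<in> S \<Longrightarrow> h x = \<psi> e" using vals by blast
    have x: "x \<in> carrier G" using inv X by blast
    \<comment> \<open>Inverses are found by search, 0 being the identity of every table. At indices
      outside \<open>S\<close> the value \<open>\<psi> e\<close> may be no group element, so the
      second disjunct makes the search stop.\<close>
    define P where "P = (\<lambda>y e. table_mult e (\<psi> e) y = 0 \<or> table_order e \<le> y)"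
    have "computable (\<lambda>e. LEAST y. P y e)"
    proof (rule computable_Least)
      show "decidable (\<lambda>w. P (pfst w) (psnd w))"
        unfolding P_def by (intro computable_intros computable_table_mult computable_comp[OF \<psi>(1)])
      show "\<exists>y. P y e" for e unfolding P_def by blast
    qed
    moreover have "h (inv\<^bsub>G\<^esub> x) = (LEAST y. P y e)" if S: "(e, h) \<in> S" for e h
    proof -
      let ?F = "table_group (table e)"
      interpret F: group ?F by (rule group_table)
      let ?i = "inv\<^bsub>?F\<^esub> h x"
      have hx: "h x \<in> carrier ?F" using less[OF S x] by (simp add: table_group_simps)
      have lt: "\<psi> e < table_order e" "?i < table_order e"
        using less[OF S x] F.inv_closed[OF hx] \<psi>(2)[OF S] by (simp_all add: table_group_simps)
      have "P ?i e"
        unfolding P_def using F.r_inv[OF hx] table_group_simps(3)[OF lt] \<psi>(2)[OF S]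
        by (simp add: table_group_simps(2))
      then have L: "P (LEAST y. P y e) e" "(LEAST y. P y e) \<le> ?i" by (rule LeastI, rule Least_le)
      then have "(LEAST y. P y e) < table_order e" using lt(2) by simp
      with L(1) lt \<psi>(2)[OF S] have "h x \<otimes>\<^bsub>?F\<^esub> (LEAST y. P y e) = \<one>\<^bsub>?F\<^esub>" "(LEAST y. P y e) \<in> carrier ?F"
        unfolding P_def by (simp_all add: table_group_simps)
      then have "?i = (LEAST y. P y e)" using hx by (metis F.inv_equality F.inv_inv F.inv_closed F.inv_comm)
      then show ?thesis using group_hom.hom_inv[OF gh[OF S] x] by simp
    qed
    ultimately show ?case by blast
  next
    case (eng x y)
    then obtain \<psi> \<psi>' where *: "computable \<psi>" "\<forall>(e, h)\<in>S. h x = \<psi> e" "computable \<psi>'" "\<forall>(e, h)\<in>S. h y = \<psi>' e"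
      by blast
    have xy: "x \<in> carrier G" "y \<in> carrier G" using eng.hyps generate_in_carrier[OF X] by blast+
    have "h (x \<otimes>\<^bsub>G\<^esub> y) = table_mult e (\<psi> e) (\<psi>' e)" if S: "(e, h) \<in> S" for e h
    proof -
      have "h x = \<psi> e" "h y = \<psi>' e" using *(2,4) S by auto
      then show ?thesis
        using group_hom.hom_mult[OF gh[OF S] xy] less[OF S xy(1)] less[OF S xy(2)]
        by (simp add: table_group_simps)
    qed
    moreover have "computable (\<lambda>e. table_mult e (\<psi> e) (\<psi>' e))"
      by (intro computable_table_mult computable_intros *)
    ultimately show ?case by blast
  qed
qed

text \<open>\<open>table_marks e\<close> knows of no hole, so it marks \<open>hole e u\<close>, but
  not its negative; the images of \<open>b\<close> and \<open>a\<close> therefore do not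
  commute.\<close>

lemma table_no_hom:
  assumes halts: "halts_at e u" and G: "group G" and h: "h \<in> hom G (table_group (table e))"
    and t: "t \<in> carrier G" "h t = step_code e" and a: "a \<in> carrier G" "h a = toggle_code e"
  defines "b \<equiv> t [^]\<^bsub>G\<^esub> hole e u \<otimes>\<^bsub>G\<^esub> a \<otimes>\<^bsub>G\<^esub> inv\<^bsub>G\<^esub> (t [^]\<^bsub>G\<^esub> hole e u)"
  shows "b \<otimes>\<^bsub>G\<^esub> a \<noteq> a \<otimes>\<^bsub>G\<^esub> b"
proof
  assume comm: "b \<otimes>\<^bsub>G\<^esub> a = a \<otimes>\<^bsub>G\<^esub> b"
  interpret group G by (rule G)
  define f where "f = lamp_decode (2 ^ (e + 2)) \<circ> h"
  have f: "f \<in> hom G (table_lamps e)"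
    unfolding f_def by (rule Group.hom_compose[OF h]) (rule iso_imp_homomorphism[OF iso_table_decode])
  have ft: "f t = step_elem" and fa: "f a = toggle_elem (2 ^ (e + 2))"
    unfolding f_def comp_def t(2) a(2) by (rule step_code(2), rule toggle_code(2))
  have b: "b \<in> carrier G" unfolding b_def using t a by simp
  have fb: "f b = step_elem [^]\<^bsub>table_lamps e\<^esub> hole e u \<otimes>\<^bsub>table_lamps e\<^esub> toggle_elem (2 ^ (e + 2))
      \<otimes>\<^bsub>table_lamps e\<^esub> inv\<^bsub>table_lamps e\<^esub> (step_elem [^]\<^bsub>table_lamps e\<^esub> hole e u)"
    unfolding b_def hom_conj_pow[OF G group_table_lamps f t(1) a(1)] ft fa ..
  have "f b \<otimes>\<^bsub>table_lamps e\<^esub> f a = f a \<otimes>\<^bsub>table_lamps e\<^esub> f b"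
    using comm hom_mult[OF f] a b by metis
  moreover have "(2::int) \<le> 2 ^ (e + 2)" using power_increasing[of 1 "e + 2" "2::int"] by simp
  ultimately have "table_marks e (int (hole e u)) = table_marks e (- int (hole e u))"
    unfolding fb fa using toggle_commute_iff[OF _ periodic_table_marks] by blast
  moreover have "int (hole e u) mod 2 ^ (e + 2) = 2 ^ e"
    unfolding residue_iff by (intro exI[of _ "int u"]) (simp add: hole_def algebra_simps)
  moreover have "(- int (hole e u)) mod 2 ^ (e + 2) \<noteq> 2 ^ e"
  proof
    assume "(- int (hole e u)) mod 2 ^ (e + 2) = 2 ^ e"
    then obtain k where "- int (hole e u) = 2 ^ e * (4 * k + 1)" unfolding residue_iff ..
    then have "2 ^ e * (- (4 * int u + 1)) = 2 ^ e * (4 * k + 1)" by (simp add: hole_def algebra_simps)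
    then have "- (4 * int u + 1) = 4 * k + 1" by simp
    then show False by presburger
  qed
  ultimately show False unfolding table_marks_def by simp
qed

theorem theorem1:
  shows "\<exists>G :: nat monoid. group G \<and> finitely_generated G \<and> residually_finite G \<and>
           solvable_WP G \<and> \<not> has_CFQ G"
proof -
  define P where "P = product_group UNIV factor"
  have P: "group P" unfolding P_def by (rule product_group) (rule group_factor)
  interpret P: group P by (rule P)
  let ?t = "\<lambda>e::nat. step_elem" and ?a = "\<lambda>e. toggle_elem (int (period e))"
  have ta: "set [?t, ?a] \<subseteq> carrier P"
    using generators_closed[OF period_ge_2] by (auto simp: P_def)
  let ?C = "generate P (set [?t, ?a])"
  have C: "subgroup ?C P" by (rule P.generate_is_subgroup[OF ta])
  have "countable ?C"
    by (rule countable_subset[OF generate_subset_word_val[OF P ta]]) simp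
  then obtain G :: "nat monoid" and \<phi> where G: "group G" and \<phi>: "\<phi> \<in> iso G (P\<lparr>carrier := ?C\<rparr>)"
    using countable_group_iso_nat[OF subgroup.subgroup_is_group[OF C P]] by auto
  interpret G: group G by (rule G)
  have inj: "inj_on \<phi> (carrier G)" and im: "\<phi> ` carrier G = ?C"
    using \<phi> by (auto simp: iso_def bij_betw_def)
  have "\<phi> \<in> hom G P"
    using \<phi> subgroup.subset[OF C] by (fastforce simp: iso_def hom_def)
  then interpret \<phi>: group_hom G P \<phi> using G P by (simp add: group_hom_def group_hom_axioms_def)
  have comp: "(\<lambda>g. \<phi> g e) \<in> hom G (factor e)" for e
    using \<phi>.homh by (auto simp: hom_def P_def Pi_iff PiE_iff)
  have one_iff: "g = \<one>\<^bsub>G\<^esub> \<longleftrightarrow> (\<forall>e. \<phi> g e = \<one>\<^bsub>factor e\<^esub>)" if "g \<in> carrier G" for g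
  proof -
    have "g = \<one>\<^bsub>G\<^esub> \<longleftrightarrow> \<phi> g = \<one>\<^bsub>P\<^esub>" using inj that \<phi>.hom_one by (metis G.one_closed inj_onD)
    also have "\<dots> \<longleftrightarrow> (\<forall>e. \<phi> g e = \<one>\<^bsub>factor e\<^esub>)" by (auto simp: P_def fun_eq_iff)
    finally show ?thesis .
  qed
  have "?t \<in> ?C" "?a \<in> ?C" by (auto intro: generate.incl)
  then have "?t \<in> \<phi> ` carrier G" "?a \<in> \<phi> ` carrier G" by (simp_all only: im)
  then obtain t a where t: "t \<in> carrier G" "\<phi> t = ?t" and a: "a \<in> carrier G" "\<phi> a = ?a"
    by (elim imageE) simp
  have gens: "set [t, a] \<subseteq> carrier G" using t a by simp
  have fin_gen: "fin_generates G [t, a]"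
  proof -
    have "\<phi> ` generate G (set [t, a]) = \<phi> ` carrier G"
      using \<phi>.generate_img[OF gens] t a im by simp
    then have "generate G (set [t, a]) = carrier G"
      using inj G.generate_incl[OF gens] by (meson inj_on_image_eq_iff order_refl)
    then show ?thesis using gens by (simp add: fin_generates_def)
  qed
  have "finitely_generated G" using fin_gen unfolding finitely_generated_def ..
  moreover have "residually_finite G"
    unfolding residually_finite_def
  proof (intro ballI impI)
    fix g assume g: "g \<in> carrier G" "g \<noteq> \<one>\<^bsub>G\<^esub>"
    then obtain e where e: "\<phi> g e \<noteq> \<one>\<^bsub>factor e\<^esub>" using one_iff by blast
    have fin: "finite (carrier (factor e))"
      using bij_betw_finite[OF bij_betw_lamp_decode[OF period_pos]] by blast
    then obtain K :: "nat monoid" and d where K: "group K" and d: "d \<in> iso K (factor e)"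
      using countable_group_iso_nat[OF group_factor] countable_finite by metis
    define d' where "d' = inv_into (carrier K) d"
    have d': "d' \<in> iso (factor e) K" unfolding d'_def by (rule group.iso_set_sym[OF K d])
    interpret d': group_hom "factor e" K d'
      using d' group_factor K by (simp add: group_hom_def group_hom_axioms_def iso_def)
    have ge: "\<phi> g e \<in> carrier (factor e)" using comp g(1) by (auto simp: hom_def)
    have "finite (carrier K)" using d fin bij_betw_finite by (auto simp: iso_def)
    moreover have "d' \<circ> (\<lambda>g. \<phi> g e) \<in> hom G K" by (rule Group.hom_compose[OF comp d'.homh])
    moreover have "(d' \<circ> (\<lambda>g. \<phi> g e)) g \<noteq> \<one>\<^bsub>K\<^esub>"
    proof
      assume "(d' \<circ> (\<lambda>g. \<phi> g e)) g = \<one>\<^bsub>K\<^esub>"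
      then have "d' (\<phi> g e) = d' \<one>\<^bsub>factor e\<^esub>" by simp
      moreover have "inj_on d' (carrier (factor e))" using d' by (simp add: iso_def bij_betw_def)
      ultimately show False using e ge by (meson d'.G.one_closed inj_onD)
    qed
    ultimately show "\<exists>(F :: nat monoid) h. group F \<and> finite (carrier F) \<and> h \<in> hom G F \<and> h g \<noteq> \<one>\<^bsub>F\<^esub>"
      using K by blast
  qed
  moreover have "solvable_WP G"
  proof -
    define c where "c = (\<lambda>n. if trivial_word (list_nth n) (list_len n) then 1 else 0 :: nat)"
    have "computable c" using decidable_trivial_word unfolding decidable_def c_def .
    moreover have "c (list_encode w) = (if word_val G [t, a] w = \<one>\<^bsub>G\<^esub> then 1 else 0)"
      if w: "valid_word [t, a] w" for w
    proof -
      let ?f = "list_nth (list_encode w)"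
      have w_eq: "map ?f [0..<length w] = w" by (rule nth_equalityI) auto
      have "word_val G [t, a] w = \<one>\<^bsub>G\<^esub> \<longleftrightarrow> (\<forall>e. \<phi> (word_val G [t, a] w) e = \<one>\<^bsub>factor e\<^esub>)"
        by (rule one_iff[OF word_val_closed[OF G gens w]])
      also have "\<dots> \<longleftrightarrow> (\<forall>e. word_val (factor e) [step_elem, toggle_elem (int (period e))] (map ?f [0..<length w]) = \<one>\<^bsub>factor e\<^esub>)"
        unfolding w_eq using hom_word_val[OF G group_factor comp gens w] by (simp add: t a)
      also have "\<dots> \<longleftrightarrow> trivial_word ?f (length w)"
        by (rule trivial_word_iff) (use w in \<open>auto simp: valid_word_def\<close>)
      finally show ?thesis by (simp add: c_def)
    qed
    ultimately show ?thesis using fin_gen unfolding solvable_WP_def solvable_WP_wrt_def by blast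
  qed
  moreover have "\<not> has_CFQ G"
  proof
    assume "has_CFQ G"
    \<comment> \<open>The list \<open>gs\<close> is arbitrary, while the intended quotient is
      described on \<open>t, a\<close>.\<close>
    then obtain gs c where gs: "fin_generates G gs" and c: "computable c"
      and c_eq: "\<And>tab fl. valid_marked gs tab fl \<Longrightarrow>
        c (marked_code tab fl) = (if extends_to_hom G gs tab fl then 1 else 0)"
      unfolding has_CFQ_def CFQ_wrt_def by blast
    define dec where "dec = (\<lambda>e. inv_into (carrier (table_group (table e))) (lamp_decode (2 ^ (e + 2))))"
    \<comment> \<open>For a non-halting \<open>e\<close> the factor is the group of the table, and
      \<open>h e\<close> is the projection onto it read through the numbering. Only for these
      \<open>e\<close> is it claimed to be a homomorphism into the table group.\<close>
    define h where "h = (\<lambda>e g. dec e (\<phi> g e))"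
    have factor_eq: "factor e = table_lamps e" if "\<not> (\<exists>u. halts_at e u)" for e
      using that by (simp add: period_def marks_def[abs_def] table_marks_def[abs_def])
    have h_hom: "h e \<in> hom G (table_group (table e))" if "\<not> (\<exists>u. halts_at e u)" for e
    proof -
      have "dec e \<in> hom (table_lamps e) (table_group (table e))"
        unfolding dec_def by (rule iso_imp_homomorphism[OF group.iso_set_sym[OF group_table iso_table_decode]])
      from Group.hom_compose[OF comp[of e, unfolded factor_eq[OF that]] this]
      show ?thesis by (simp add: h_def comp_def)
    qed
    have dec_decode: "dec e (lamp_decode (2 ^ (e + 2)) x) = x" if "x < table_order e" for e x
      unfolding dec_def using iso_table_decode[of e] that
      by (intro inv_into_f_f) (auto simp: iso_def bij_betw_def table_group_simps)
    have h_t: "h e t = step_code e" if "\<not> (\<exists>u. halts_at e u)" for e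
      unfolding h_def t(2) step_code(2)[symmetric, of e] by (rule dec_decode[OF step_code(1)])
    have h_a: "h e a = toggle_code e" if "\<not> (\<exists>u. halts_at e u)" for e
    proof -
      have "int (period e) = 2 ^ (e + 2)" using that by (simp add: period_def)
      moreover have "dec e (toggle_elem (2 ^ (e + 2))) = toggle_code e"
        using dec_decode[OF toggle_code(1)[of e]] unfolding toggle_code(2) .
      ultimately show ?thesis unfolding h_def a(2) by (simp only:)
    qed
    define S1 where "S1 = {(e, h e) |e. \<not> (\<exists>u. halts_at e u)}"
    have "\<exists>\<psi>. computable \<psi> \<and> (\<forall>e. \<psi> e < table_order e) \<and> (\<forall>(e, h)\<in>S1. h g = \<psi> e)"
      if g: "g \<in> carrier G" for g
    proof -
      have comp_t: "computable step_code" unfolding step_code_def by (intro computable_intros)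
      have comp_a: "computable toggle_code" unfolding toggle_code_def by (intro computable_intros)
      have "\<exists>\<psi>. computable \<psi> \<and> (\<forall>(e, h)\<in>S1. h g = \<psi> e)"
      proof (rule computable_hom_values[OF G _ gens])
        show "h' \<in> hom G (table_group (table e))" if "(e, h') \<in> S1" for e h'
          using that h_hom by (auto simp: S1_def)
        show "\<exists>\<psi>. computable \<psi> \<and> (\<forall>(e, h)\<in>S1. h x = \<psi> e)" if "x \<in> set [t, a]" for x
          using that comp_t comp_a h_t h_a by (auto simp: S1_def)
        show "g \<in> generate G (set [t, a])" using fin_gen g by (simp add: fin_generates_def)
      qed
      then obtain \<psi> where \<psi>: "computable \<psi>" "\<forall>(e, h)\<in>S1. h g = \<psi> e" by blast
      have "h e g < table_order e" if "\<not> (\<exists>u. halts_at e u)" for e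
        using h_hom[OF that] g by (auto simp: hom_def table_group_simps)
      \<comment> \<open>\<open>c\<close> is specified only on valid markings, and it will be asked
        about every \<open>e\<close>; a value outside the table, possible for halting
        \<open>e\<close>, is replaced by the identity 0.\<close>
      then have "\<forall>(e, h)\<in>S1. h g = (if \<psi> e < table_order e then \<psi> e else 0)"
        using \<psi>(2) by (auto simp: S1_def)
      moreover have "computable (\<lambda>e. if \<psi> e < table_order e then \<psi> e else 0)"
        by (intro computable_intros \<psi>(1))
      ultimately show ?thesis using table_order_pos
        by (intro exI[of _ "\<lambda>e. if \<psi> e < table_order e then \<psi> e else 0"]) simp
    qed
    then obtain \<Psi> where \<Psi>: "\<And>g. g \<in> carrier G \<Longrightarrow>
        computable (\<Psi> g) \<and> (\<forall>e. \<Psi> g e < table_order e) \<and> (\<forall>(e, h)\<in>S1. h g = \<Psi> g e)"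
      by metis
    have gs_in: "set gs \<subseteq> carrier G" using gs by (simp add: fin_generates_def)
    define fl where "fl = (\<lambda>e. map (\<lambda>f. f e) (map \<Psi> gs))"
    have valid: "valid_marked gs (table e) (fl e)" for e
      using \<Psi> gs_in by (intro valid_marked_table) (auto simp: fl_def subset_iff)
    \<comment> \<open>All homomorphisms extending the marking, also for halting \<open>e\<close>.
      Their values on \<open>t, a\<close> are computed back from \<open>gs\<close>, since a positive
      answer of \<open>c\<close> says nothing directly about \<open>t, a\<close>.\<close>
    define S2 where "S2 = {(e, h). h \<in> hom G (table_group (table e)) \<and> (\<forall>i<length gs. h (gs ! i) = fl e ! i)}"
    have S2_val: "\<exists>\<psi>. computable \<psi> \<and> (\<forall>(e, h)\<in>S2. h g = \<psi> e)" if g: "g \<in> carrier G" for g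
    proof (rule computable_hom_values[OF G _ gs_in])
      show "h' \<in> hom G (table_group (table e))" if "(e, h') \<in> S2" for e h'
        using that by (simp add: S2_def)
      show "\<exists>\<psi>. computable \<psi> \<and> (\<forall>(e, h)\<in>S2. h x = \<psi> e)" if "x \<in> set gs" for x
      proof (intro exI conjI)
        show "computable (\<Psi> x)" using \<Psi> that gs_in by blast
        show "\<forall>(e, h)\<in>S2. h x = \<Psi> x e" using that by (auto simp: S2_def fl_def in_set_conv_nth)
      qed
      show "g \<in> generate G (set gs)" using gs g by (simp add: fin_generates_def)
    qed
    obtain \<tau> where \<tau>: "computable \<tau>" "\<forall>(e, h)\<in>S2. h t = \<tau> e" using S2_val[OF t(1)] by blast
    obtain \<alpha> where \<alpha>: "computable \<alpha>" "\<forall>(e, h)\<in>S2. h a = \<alpha> e" using S2_val[OF a(1)] by blast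
    have S1_S2: "(e, h e) \<in> S2" if "\<not> (\<exists>u. halts_at e u)" for e
    proof -
      have "h e (gs ! i) = fl e ! i" if "i < length gs" for i
      proof -
        have "gs ! i \<in> carrier G" using gs_in that by (meson nth_mem subsetD)
        moreover have "(e, h e) \<in> S1" using \<open>\<not> (\<exists>u. halts_at e u)\<close> by (auto simp: S1_def)
        ultimately have "h e (gs ! i) = \<Psi> (gs ! i) e" using \<Psi> by blast
        then show ?thesis using that by (simp add: fl_def)
      qed
      then show ?thesis using h_hom[OF that] by (simp add: S2_def)
    qed
    \<comment> \<open>The reduction: \<open>\<tau> e\<close> and \<open>\<alpha> e\<close> are the
      only values an extension of \<open>fl e\<close> can take on \<open>t\<close> and
      \<open>a\<close>, so testing them ensures that the extension is the intended quotient
      map.\<close>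
    have "(\<not> (\<exists>u. halts_at e u)) \<longleftrightarrow>
        c (marked_code (table e) (fl e)) = 1 \<and> \<tau> e = step_code e \<and> \<alpha> e = toggle_code e" for e
    proof
      assume e: "\<not> (\<exists>u. halts_at e u)"
      have "extends_to_hom G gs (table e) (fl e)"
        using S1_S2[OF e] unfolding extends_to_hom_def S2_def by blast
      then show "c (marked_code (table e) (fl e)) = 1 \<and> \<tau> e = step_code e \<and> \<alpha> e = toggle_code e"
        using c_eq[OF valid] S1_S2[OF e] h_t[OF e] h_a[OF e] \<tau>(2) \<alpha>(2) by auto
    next
      assume *: "c (marked_code (table e) (fl e)) = 1 \<and> \<tau> e = step_code e \<and> \<alpha> e = toggle_code e"
      then have "extends_to_hom G gs (table e) (fl e)" using c_eq[OF valid] by (simp split: if_splits)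
      then obtain k where k: "k \<in> hom G (table_group (table e))" "(e, k) \<in> S2"
        unfolding extends_to_hom_def S2_def by blast
      then have kt: "k t = step_code e" "k a = toggle_code e" using * \<tau>(2) \<alpha>(2) by auto
      show "\<not> (\<exists>u. halts_at e u)"
      proof
        assume "\<exists>u. halts_at e u"
        then obtain u where u: "halts_at e u" ..
        define b where "b = t [^]\<^bsub>G\<^esub> hole e u \<otimes>\<^bsub>G\<^esub> a \<otimes>\<^bsub>G\<^esub> inv\<^bsub>G\<^esub> (t [^]\<^bsub>G\<^esub> hole e u)"
        have b: "b \<in> carrier G" unfolding b_def using t a by simp
        \<comment> \<open>An equation in the product is checked factor by factor; in each one
          neither \<open>hole e u\<close> nor its negative is marked.\<close>
        have "\<phi> (b \<otimes>\<^bsub>G\<^esub> a) e' = \<phi> (a \<otimes>\<^bsub>G\<^esub> b) e'" for e'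
        proof -
          have "\<phi> b e' = step_elem [^]\<^bsub>factor e'\<^esub> hole e u \<otimes>\<^bsub>factor e'\<^esub> toggle_elem (int (period e'))
              \<otimes>\<^bsub>factor e'\<^esub> inv\<^bsub>factor e'\<^esub> (step_elem [^]\<^bsub>factor e'\<^esub> hole e u)"
            using hom_conj_pow[OF G group_factor comp[of e'] t(1) a(1), of "hole e u"] unfolding b_def t(2) a(2) .
          moreover have "marks e' (int (hole e u)) = marks e' (- int (hole e u))"
            using marks_hole[OF u] by simp
          ultimately have "\<phi> b e' \<otimes>\<^bsub>factor e'\<^esub> \<phi> a e' = \<phi> a e' \<otimes>\<^bsub>factor e'\<^esub> \<phi> b e'"
            using toggle_commute_iff[OF period_ge_2 periodic_marks, of e' "hole e u"] unfolding a(2) by simp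
          then show ?thesis using hom_mult[OF comp[of e']] a(1) b by simp
        qed
        then have "b \<otimes>\<^bsub>G\<^esub> a = a \<otimes>\<^bsub>G\<^esub> b"
          using inj a(1) b by (intro inj_onD[OF inj] ext) auto
        then show False
          using table_no_hom[OF u G k(1) t(1) kt(1) a(1) kt(2)] unfolding b_def by blast
      qed
    qed
    moreover have "decidable (\<lambda>e. c (marked_code (table e) (fl e)) = 1 \<and> \<tau> e = step_code e \<and> \<alpha> e = toggle_code e)"
    proof -
      have "computable (\<lambda>e. list_encode (fl e))"
        unfolding fl_def by (rule computable_list_encode_map) (use \<Psi> gs_in in \<open>auto simp: subset_iff\<close>)
      then have "computable (\<lambda>e. marked_code (table e) (fl e))"
        unfolding marked_code_def by (intro computable_intros computable_table)
      from computable_comp[OF c this] show ?thesis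
        unfolding step_code_def toggle_code_def by (intro computable_intros \<tau> \<alpha>)
    qed
    ultimately have "decidable (\<lambda>e. \<not> (\<exists>u. halts_at e u))" by simp
    from decidable_not[OF this] show False using undecidable_halts by simp
  qed
  ultimately show ?thesis using G by blast
qed

end
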